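(* Let $q$ be a prime power, $m,n\ge 1$, and let $\mathcal{C}$ be an $(n,k)$ linear code over $\mathrm{GF}(q^m)$ with rank weight enumerator $W^{\mathrm{R}}_{\mathcal{C}}(x,y)=\sum_{i=0}^n A_i y^i x^{n-i}$, and let $W^{\mathrm{R}}_{\mathcal{C}^\perp}(x,y)=\sum_{j=0}^n B_j y^j x^{n-j}$ be the rank weight enumerator of its dual code $\mathcal{C}^\perp$. Then $$W^{\mathrm{R}}_{\mathcal{C}^\perp}(x,y)=\frac{1}{|\mathcal{C}|}\,\bar W^{\mathrm{R}}_{\mathcal{C}}\big(x+(q^m-1)y,\;x-y\big),$$ where $\bar W^{\mathrm{R}}_{\mathcal{C}}$ is the $q$-transform of $W^{\mathrm{R}}_{\mathcal{C}}$; equivalently, $$\sum_{j=0}^n B_j y^j x^{n-j}=q^{m(k-n)}\sum_{i=0}^n A_i\,(x-y)^{[i]}*\big[x+(q^m-1)y\big]^{[n-i]}.$$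
   Context: For $\mathbf{x}=(x_0,\dots,x_{n-1})\in\mathrm{GF}(q^m)^n$, the rank $\mathrm{rk}(\mathbf{x})$ is the dimension over $\mathrm{GF}(q)$ of the $\mathrm{GF}(q)$-linear span of $x_0,\dots,x_{n-1}$ in $\mathrm{GF}(q^m)$ (equivalently, the rank over $\mathrm{GF}(q)$ of the $m\times n$ matrix obtained by expanding each coordinate in a basis of $\mathrm{GF}(q^m)$ over $\mathrm{GF}(q)$). An $(n,k)$ linear code is a $k$-dimensional $\mathrm{GF}(q^m)$-subspace of $\mathrm{GF}(q^m)^n$; its dual is $\mathcal{C}^\perp=\{\mathbf{u}:\sum_i u_ic_i=0\ \forall \mathbf{c}\in\mathcal{C}\}$. The rank weight enumerator of $\mathcal{C}$ is $\sum_{\mathbf{c}\in\mathcal{C}}y^{\mathrm{rk}(\mathbf{c})}x^{n-\mathrm{rk}(\mathbf{c})}$. $q$-product: for homogeneous polynomials $a(x,y;m)=\sum_{i=0}^r a_i(m)y^ix^{r-i}$ and $b(x,y;m)=\sum_{j=0}^s b_j(m)y^jx^{s-j}$ of degrees $r,s$, whose coefficients are real functions of $m$ (taken to be zero for indices outside the given ranges), $a*b$ is the homogeneous polynomial of degree $r+s$ given by $\sum_{u=0}^{r+s}c_u(m)y^ux^{r+s-u}$ with $c_u(m)=\sum_{i=0}^u q^{is}a_i(m)b_{u-i}(m-i)$. The $q$-powers are $a^{[0]}=1$ and $a^{[l]}=a^{[l-1]}*a$ for $l\ge1$. Here $x+(q^m-1)y$ is the degree-1 polynomial with coefficients $a_0(m)=1$,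 $a_1(m)=q^m-1$, and $x-y$ has coefficients $1,-1$. The $q$-transform of $a(x,y;m)=\sum_{i=0}^r a_i(m)y^ix^{r-i}$ is $\bar a(x,y;m)=\sum_{i=0}^r a_i(m)\,y^{[i]}*x^{[r-i]}$, and $\bar a(X,Y)$ means $\sum_i a_i(m)\,Y^{[i]}*X^{[r-i]}$. *)

theory Defs
  imports "HOL-Analysis.Analysis"
begin

section \<open>Subfields, GF(q)-span and rank weight\<close>

definition is_subfield :: "'a::field set \<Rightarrow> bool" where
  "is_subfield F \<longleftrightarrow> 0 \<in> F \<and> 1 \<in> F \<and>
     (\<forall>a\<in>F. \<forall>b\<in>F. a + b \<in> F \<and> a * b \<in> F) \<and>
     (\<forall>a\<in>F. - a \<in> F \<and> inverse a \<in> F)"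

text \<open>The F-linear span of a set S of field elements.\<close>
definition Fspan :: "'a::field set \<Rightarrow> 'a set \<Rightarrow> 'a set" where
  "Fspan F S = {(\<Sum>s\<in>T. c s * s) | T c. finite T \<and> T \<subseteq> S \<and> (\<forall>s. c s \<in> F)}"

text \<open>Rank of a vector: dimension over F of the F-span of its coordinates,
  i.e. the least size of a set whose F-span contains all coordinates.\<close>
definition rk :: "'a::field set \<Rightarrow> 'a ^ 'n \<Rightarrow> nat" where
  "rk F x = (LEAST d. \<exists>B. finite B \<and> card B = d \<and> range (\<lambda>i. x $ i) \<subseteq> Fspan F B)"

definition dual_code :: "('a::field ^ 'n) set \<Rightarrow> ('a ^ 'n) set" where
  "dual_code C = {u. \<forall>c\<in>C. (\<Sum>i\<in>UNIV. u $ i * c $ i) = 0}"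

section \<open>Homogeneous polynomials with m-dependent coefficients\<close>

text \<open>A homogeneous polynomial (degree r, coefficients a i m) where
  a i m is the coefficient of y^i x^(r-i); m ranges over integers since
  the q-product shifts m downwards.\<close>
type_synonym hpoly = "nat \<times> (nat \<Rightarrow> int \<Rightarrow> real)"

definition hc :: "hpoly \<Rightarrow> nat \<Rightarrow> int \<Rightarrow> real" where
  "hc a i m = (if i \<le> fst a then snd a i m else 0)"

definition qprod :: "nat \<Rightarrow> hpoly \<Rightarrow> hpoly \<Rightarrow> hpoly" where
  "qprod q a b = (fst a + fst b,
     \<lambda>u m. \<Sum>i=0..u. real q ^ (i * fst b) * hc a i m * hc b (u - i) (m - int i))"

primrec qpow :: "nat \<Rightarrow> hpoly \<Rightarrow> nat \<Rightarrow> hpoly" where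
  "qpow q a 0 = (0, \<lambda>i m. if i = 0 then 1 else 0)"
| "qpow q a (Suc l) = qprod q (qpow q a l) a"

text \<open>x + (q^m - 1) y and x - y\<close>
definition Xpoly :: "nat \<Rightarrow> hpoly" where
  "Xpoly q = (1, \<lambda>i m. if i = 0 then 1 else if i = 1 then real q powi m - 1 else 0)"

definition Ypoly :: hpoly where
  "Ypoly = (1, \<lambda>i m. if i = 0 then 1 else if i = 1 then -1 else 0)"

text \<open>q-transform evaluated at (X, Y): sum_i a_i(m) Y^[i] * X^[r-i].\<close>
definition qtransform_at :: "nat \<Rightarrow> hpoly \<Rightarrow> hpoly \<Rightarrow> hpoly \<Rightarrow> hpoly" where
  "qtransform_at q a X Y = (fst a * fst X,
     \<lambda>u m. \<Sum>i=0..fst a. hc a i m * hc (qprod q (qpow q Y i) (qpow q X (fst a - i))) u m)"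

text \<open>Rank weight enumerator of a code C (coefficient i = number of codewords of rank i).\<close>
definition rank_we :: "'a::field set \<Rightarrow> ('a ^ 'n) set \<Rightarrow> hpoly" where
  "rank_we F C = (CARD('n), \<lambda>i m. real (card {c\<in>C. rk F c = i}))"

end

(*
  Both enumerators are compared through their moments against Gaussian binomial
  coefficients [N, u] (q-binomials). Let K be the big field, F = GF(q) its subfield,
  Q = q^m = |K| and n the length of the code. Counting the pairs
  (x, U) with x in C and U an F-subspace of F^n of dimension u orthogonal to x gives

    Q^u * sum_{x in C} [n - rk x, u] = |C| * sum_{y in C^perp} [n - rk y, n - u]:

  for fixed x the vectors of F^n orthogonal to x form a space of dimension n - rk x; for
  fixed U, with W the orthogonal complement of U in K^n, one has
  |C cap W| |W^perp| = |C| |C^perp cap W^perp|, and U |-> U^perp (over F) is a bijection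
  between the F-subspaces of dimensions u and n - u.
  On the polynomial side, the coefficients P_ij of (x - y)^[i] * (x + (Q - 1) y)^[n-i]
  satisfy sum_j P_ij [n - j, n - u] = Q^u [n - i, u], by induction on n with the q-Pascal
  rule. As the matrix ([n - j, n - u])_{u,j} is triangular with unit diagonal, these
  moments determine the coefficients of the dual enumerator.
*)

theory Submission
  imports Defs
begin

section \<open>Gaussian binomial coefficients\<close>

text \<open>For a prime power \<open>q\<close>, \<open>qframes q N k\<close> counts the linearly independent \<open>k\<close>-tuples
  in an \<open>N\<close>-dimensional space over \<open>GF(q)\<close>.\<close>

definition qframes :: "real \<Rightarrow> nat \<Rightarrow> nat \<Rightarrow> real" where
  "qframes q N k = (\<Prod>t<k. q ^ N - q ^ t)"

definition gauss_binom :: "real \<Rightarrow> nat \<Rightarrow> nat \<Rightarrow> real" where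
  "gauss_binom q N k = qframes q N k / qframes q k k"

definition gauss_binomi :: "real \<Rightarrow> nat \<Rightarrow> int \<Rightarrow> real" where
  "gauss_binomi q N k = (if k < 0 then 0 else gauss_binom q N (nat k))"

lemma qframes_0 [simp]: "qframes q N 0 = 1"
  by (simp add: qframes_def)

lemma qframes_Suc: "qframes q N (Suc k) = qframes q N k * (q ^ N - q ^ k)"
  by (simp add: qframes_def)

lemma qframes_Suc_Suc: "qframes q (Suc N) (Suc k) = (q ^ Suc N - 1) * q ^ k * qframes q N k"
proof -
  have "qframes q (Suc N) (Suc k) = (q ^ Suc N - q ^ 0) * (\<Prod>t<k. q * (q ^ N - q ^ t))"
    unfolding qframes_def prod.lessThan_Suc_shift by (simp add: algebra_simps)
  then show ?thesis
    by (simp add: qframes_def prod.distrib)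
qed

lemma qframes_eq_0: "N < k \<Longrightarrow> qframes q N k = 0"
  unfolding qframes_def by (rule prod_zero) auto

lemma qframes_pos: "1 < q \<Longrightarrow> k \<le> N \<Longrightarrow> 0 < qframes q N k"
  unfolding qframes_def by (rule prod_pos) (auto intro!: power_strict_increasing)

lemma gauss_binom_0 [simp]: "gauss_binom q N 0 = 1"
  by (simp add: gauss_binom_def)

lemma gauss_binom_eq_0: "N < k \<Longrightarrow> gauss_binom q N k = 0"
  by (simp add: gauss_binom_def qframes_eq_0)

lemma gauss_binom_self: "1 < q \<Longrightarrow> gauss_binom q N N = 1"
  using qframes_pos[of q N N] by (simp add: gauss_binom_def)

lemma gauss_binom_Suc_Suc:
  assumes "1 < q"
  shows "gauss_binom q (Suc N) (Suc k) = gauss_binom q N k + q ^ Suc k * gauss_binom q N (Suc k)"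
    and "q ^ Suc k * gauss_binom q (Suc N) (Suc k)
           = q ^ Suc N * gauss_binom q N k + q ^ Suc k * gauss_binom q N (Suc k)"
  using qframes_pos[OF assms, of k k] one_less_power[OF assms, of "Suc k"] assms
  by (simp_all add: gauss_binom_def qframes_Suc_Suc qframes_Suc[of q N k] field_simps)

lemma gauss_binomi_0: "gauss_binomi q 0 s = (if s = 0 then 1 else 0)"
  by (auto simp: gauss_binomi_def gauss_binom_eq_0)

lemma int_cases_neg_0_Suc:
  obtains "k < 0" | "k = 0" | k' where "k = int (Suc k')"
  by (metis not0_implies_Suc not_less nonneg_int_cases of_nat_0)

lemma gauss_binomi_Suc:
  assumes q: "1 < q"
  shows "gauss_binomi q (Suc N) k = gauss_binomi q N (k - 1) + q powi k * gauss_binomi q N k"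
    and "q powi k * gauss_binomi q (Suc N) k
           = q ^ Suc N * gauss_binomi q N (k - 1) + q powi k * gauss_binomi q N k"
proof -
  have "nat (int (Suc k') - 1) = k'" "q powi int (Suc k') = q ^ Suc k'" for k'
    by (simp_all only: power_int_of_nat)
  with gauss_binom_Suc_Suc[OF q] show
    "gauss_binomi q (Suc N) k = gauss_binomi q N (k - 1) + q powi k * gauss_binomi q N k"
    "q powi k * gauss_binomi q (Suc N) k
       = q ^ Suc N * gauss_binomi q N (k - 1) + q powi k * gauss_binomi q N k"
    by (cases k rule: int_cases_neg_0_Suc; simp add: gauss_binomi_def q del: of_nat_Suc)+
qed

lemma gauss_binom_triangular_eq_0:
  fixes D :: "nat \<Rightarrow> real"
  assumes q: "1 < q" and D: "\<And>u. u \<le> n \<Longrightarrow> (\<Sum>j=0..n. D j * gauss_binom q (n - j) (n - u)) = 0"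
  shows "j \<le> n \<Longrightarrow> D j = 0"
proof (induction j rule: less_induct)
  case (less j)
  have "D j' * gauss_binom q (n - j') (n - j) = (if j' = j then D j else 0)" if "j' \<in> {0..n}" for j'
  proof (cases j' j rule: linorder_cases)
    case greater
    with that less.prems show ?thesis
      by (simp add: gauss_binom_eq_0)
  qed (use less that q in \<open>simp_all add: gauss_binom_self\<close>)
  then have "(\<Sum>j'=0..n. D j' * gauss_binom q (n - j') (n - j)) = (\<Sum>j'=0..n. if j' = j then D j else 0)"
    by (rule sum.cong[OF refl])
  with D[OF less.prems] less.prems show ?case
    by simp
qed

section \<open>Coefficients of q-products\<close>

lemma hc_Pair: "hc (r, f) i m = (if i \<le> r then f i m else 0)"
  by (simp add: hc_def)

lemma hc_eq_0: "fst a < i \<Longrightarrow> hc a i m = 0"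
  by (simp add: hc_def)

lemma fst_qprod [simp]: "fst (qprod q a b) = fst a + fst b"
  by (simp add: qprod_def)

lemma fst_qpow [simp]: "fst (qpow q a l) = l * fst a"
  by (induction l) auto

lemma fst_Xpoly [simp]: "fst (Xpoly q) = 1"
  by (simp add: Xpoly_def)

lemma fst_Ypoly [simp]: "fst Ypoly = 1"
  by (simp add: Ypoly_def)

lemma hc_Xpoly: "hc (Xpoly q) v m = (if v = 0 then 1 else if v = 1 then real q powi m - 1 else 0)"
  by (simp add: hc_def Xpoly_def)

lemma hc_Ypoly: "hc Ypoly v m = (if v = 0 then 1 else if v = 1 then -1 else 0)"
  by (simp add: hc_def Ypoly_def)

lemma hc_qprod:
  "hc (qprod q a b) u m = (\<Sum>i=0..u. real q ^ (i * fst b) * hc a i m * hc b (u - i) (m - int i))"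
proof (cases "u \<le> fst a + fst b")
  case True
  then show ?thesis
    by (simp add: qprod_def hc_Pair)
next
  case False
  then have "real q ^ (i * fst b) * hc a i m * hc b (u - i) (m - int i) = 0" for i
    by (cases "i \<le> fst a") (simp_all add: hc_eq_0)
  then have "(\<Sum>i=0..u. real q ^ (i * fst b) * hc a i m * hc b (u - i) (m - int i)) = 0"
    by (intro sum.neutral) blast
  with False show ?thesis
    by (simp add: hc_eq_0)
qed

lemma hc_qprod_assoc: "hc (qprod q a (qprod q b c)) u m = hc (qprod q (qprod q a b) c) u m"
proof -
  define g where "g l p = real q ^ (l * fst b) * hc a l m * hc b p (m - int l) *
      (real q ^ ((l + p) * fst c) * hc c (u - (l + p)) (m - int (l + p)))" for l p
  have "hc (qprod q a (qprod q b c)) u m = (\<Sum>l\<le>u. \<Sum>p\<le>u - l. g l p)"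
    unfolding hc_qprod sum_distrib_left atLeast0AtMost
    by (intro sum.cong refl) (simp add: g_def power_add add_mult_distrib algebra_simps diff_diff_add)
  also have "\<dots> = (\<Sum>(l, p)\<in>{(l, p). l + p \<le> u}. g l p)"
    by (simp add: pairs_le_eq_Sigma sum.Sigma)
  also have "\<dots> = (\<Sum>k\<le>u. \<Sum>l\<le>k. g l (k - l))"
    by (rule sum.triangle_reindex_eq)
  also have "\<dots> = hc (qprod q (qprod q a b) c) u m"
    unfolding hc_qprod sum_distrib_left sum_distrib_right atLeast0AtMost fst_qprod
    by (intro sum.cong refl) (auto simp: g_def algebra_simps)
  finally show ?thesis .
qed

lemma hc_qprod_qpow_0: "hc (qprod q a (qpow q b 0)) u m = hc a u m"
proof -
  have "hc (qprod q a (qpow q b 0)) u m = (\<Sum>i=0..u. if i = u then hc a u m else 0)"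
    unfolding hc_qprod by (rule sum.cong) (auto simp: hc_Pair)
  then show ?thesis
    by simp
qed

lemma hc_qprod_linear:
  assumes "fst b = 1"
  shows "hc (qprod q a b) 0 m = hc a 0 m * hc b 0 m"
    and "hc (qprod q a b) (Suc u) m
           = real q ^ Suc u * hc a (Suc u) m * hc b 0 (m - int (Suc u))
             + real q ^ u * hc a u m * hc b 1 (m - int u)"
proof -
  show "hc (qprod q a b) 0 m = hc a 0 m * hc b 0 m"
    by (simp add: hc_qprod)
  have "hc (qprod q a b) (Suc u) m
      = (\<Sum>i\<in>{u, Suc u}. real q ^ (i * fst b) * hc a i m * hc b (Suc u - i) (m - int i))"
    unfolding hc_qprod using assms
    by (intro sum.mono_neutral_right) (auto simp: hc_eq_0)
  then show "hc (qprod q a b) (Suc u) m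
      = real q ^ Suc u * hc a (Suc u) m * hc b 0 (m - int (Suc u))
        + real q ^ u * hc a u m * hc b 1 (m - int u)"
    using assms by (simp add: Suc_diff_le)
qed

definition gauss_pairing :: "real \<Rightarrow> (nat \<Rightarrow> real) \<Rightarrow> nat \<Rightarrow> int \<Rightarrow> real" where
  "gauss_pairing q a n s = (\<Sum>j=0..n. a j * gauss_binomi q (n - j) (int n - s))"

lemma gauss_binomi_step:
  fixes q c :: real
  assumes q: "1 < q" and j: "j \<le> n"
  shows "q ^ j * gauss_binomi q (Suc (n - j)) (int (Suc n) - s)
           + (c - q ^ j) * gauss_binomi q (n - j) (int (Suc n) - s)
         = q powi s * gauss_binomi q (n - j) (int n - s)
           + c * gauss_binomi q (n - j) (int n - (s - 1))"
proof -
  define k where "k = int (Suc n) - s"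
  define N where "N = n - j"
  have e: "q ^ j * q ^ Suc N = q powi k * q powi s"
    using j q by (simp add: N_def k_def flip: power_add power_int_add power_int_of_nat)
  have "q powi k * (q ^ j * (gauss_binomi q (Suc N) k - gauss_binomi q N k))
      = q ^ j * (q powi k * gauss_binomi q (Suc N) k - q powi k * gauss_binomi q N k)"
    by (simp add: algebra_simps)
  also have "\<dots> = q ^ j * q ^ Suc N * gauss_binomi q N (k - 1)"
    by (simp add: gauss_binomi_Suc(2)[OF q])
  also have "\<dots> = q powi k * (q powi s * gauss_binomi q N (k - 1))"
    unfolding e by (rule mult.assoc)
  finally have "q ^ j * (gauss_binomi q (Suc N) k - gauss_binomi q N k) = q powi s * gauss_binomi q N (k - 1)"
    using q by simp
  moreover have "int n - s = k - 1" "int n - (s - 1) = k"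
    by (simp_all add: k_def)
  ultimately show ?thesis
    unfolding k_def[symmetric] N_def[symmetric] by (simp only:) (simp add: algebra_simps)
qed

text \<open>The hypotheses say that \<open>b\<close> is the coefficient sequence of the q-product of \<open>a\<close>
  with \<open>x + c y\<close> (see \<open>hc_qprod_linear\<close>); the recursion in \<open>s\<close> is the q-Pascal rule.\<close>
lemma gauss_pairing_Suc:
  fixes a b :: "nat \<Rightarrow> real" and q c :: real
  assumes q: "1 < q" and b0: "b 0 = a 0"
    and bSuc: "\<And>j. b (Suc j) = q ^ Suc j * a (Suc j) + (c - q ^ j) * a j"
    and a: "\<And>j. n < j \<Longrightarrow> a j = 0"
  shows "gauss_pairing q b (Suc n) s
       = q powi s * gauss_pairing q a n s + c * gauss_pairing q a n (s - 1)"
proof -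
  define H where "H j = gauss_binomi q (Suc n - j) (int (Suc n) - s)" for j
  define b1 where "b1 j = q ^ j * a j" for j
  define b2 where "b2 j = (if j = 0 then 0 else (c - q ^ (j - 1)) * a (j - 1))" for j
  have b: "b j = b1 j + b2 j" for j
    by (cases j) (simp_all add: b1_def b2_def b0 bSuc)
  have "(\<Sum>j=0..Suc n. b1 j * H j)
      = (\<Sum>j=0..n. q ^ j * a j * gauss_binomi q (Suc (n - j)) (int (Suc n) - s))"
    by (simp add: b1_def H_def a Suc_diff_le)
  moreover have "(\<Sum>j=0..Suc n. b2 j * H j)
      = (\<Sum>j=0..n. (c - q ^ j) * a j * gauss_binomi q (n - j) (int (Suc n) - s))"
    by (subst sum.atLeast0_atMost_Suc_shift) (simp add: b2_def H_def)
  ultimately have "gauss_pairing q b (Suc n) s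
      = (\<Sum>j=0..n. a j * (q ^ j * gauss_binomi q (Suc (n - j)) (int (Suc n) - s)
                          + (c - q ^ j) * gauss_binomi q (n - j) (int (Suc n) - s)))"
    unfolding gauss_pairing_def H_def[symmetric] b distrib_right sum.distrib
    by (simp add: sum.distrib[symmetric] algebra_simps)
  also have "\<dots> = (\<Sum>j=0..n. a j * (q powi s * gauss_binomi q (n - j) (int n - s)
                                     + c * gauss_binomi q (n - j) (int n - (s - 1))))"
  proof (intro sum.cong refl)
    fix j
    assume "j \<in> {0..n}"
    then show "a j * (q ^ j * gauss_binomi q (Suc (n - j)) (int (Suc n) - s)
                      + (c - q ^ j) * gauss_binomi q (n - j) (int (Suc n) - s))
             = a j * (q powi s * gauss_binomi q (n - j) (int n - s)
                      + c * gauss_binomi q (n - j) (int n - (s - 1)))"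
      using gauss_binomi_step[OF q, of j n s c] by simp
  qed
  finally show ?thesis
    by (simp add: gauss_pairing_def sum_distrib_left sum.distrib algebra_simps)
qed

lemma gauss_pairing_qpow_Ypoly:
  assumes q: "1 < q"
  shows "gauss_pairing (real q) (\<lambda>j. hc (qpow q Ypoly i) j M) i s = (if s = 0 then 1 else 0)"
proof (induction i arbitrary: s)
  case 0
  then show ?case
    by (simp add: gauss_pairing_def hc_Pair gauss_binomi_0)
next
  case (Suc i)
  have "gauss_pairing (real q) (\<lambda>j. hc (qpow q Ypoly (Suc i)) j M) (Suc i) s
      = real q powi s * gauss_pairing (real q) (\<lambda>j. hc (qpow q Ypoly i) j M) i s
        + 0 * gauss_pairing (real q) (\<lambda>j. hc (qpow q Ypoly i) j M) i (s - 1)"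
    by (rule gauss_pairing_Suc) (use q in \<open>simp_all add: hc_qprod_linear hc_Ypoly hc_eq_0\<close>)
  with Suc show ?case
    by simp
qed

definition qbasis_coeff :: "nat \<Rightarrow> int \<Rightarrow> nat \<Rightarrow> nat \<Rightarrow> nat \<Rightarrow> real" where
  "qbasis_coeff q M n i j = hc (qprod q (qpow q Ypoly i) (qpow q (Xpoly q) (n - i))) j M"

lemma gauss_pairing_qbasis_coeff:
  assumes q: "1 < q" and "i \<le> n"
  shows "gauss_pairing (real q) (qbasis_coeff q M n i) n s
       = (real q powi M) powi s * gauss_binomi (real q) (n - i) s"
  using \<open>i \<le> n\<close>
proof (induction n arbitrary: s rule: dec_induct)
  case base
  have "qbasis_coeff q M i i j = hc (qpow q Ypoly i) j M" for j
    unfolding qbasis_coeff_def diff_self_eq_0 by (rule hc_qprod_qpow_0)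
  then show ?case
    using q by (simp add: gauss_pairing_qpow_Ypoly gauss_binomi_0)
next
  case (step n)
  define Q where "Q = real q powi M"
  have "Q \<noteq> 0"
    using q by (simp add: Q_def)
  have "qbasis_coeff q M (Suc n) i j
      = hc (qprod q (qprod q (qpow q Ypoly i) (qpow q (Xpoly q) (n - i))) (Xpoly q)) j M" for j
    using step(1) by (simp add: qbasis_coeff_def Suc_diff_le hc_qprod_assoc)
  then have "gauss_pairing (real q) (qbasis_coeff q M (Suc n) i) (Suc n) s
      = real q powi s * gauss_pairing (real q) (qbasis_coeff q M n i) n s
        + Q * gauss_pairing (real q) (qbasis_coeff q M n i) n (s - 1)"
    using q step(1)
    by (intro gauss_pairing_Suc)
       (simp_all add: hc_qprod_linear hc_Xpoly hc_eq_0 qbasis_coeff_def Q_def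
         power_int_diff power_int_of_nat algebra_simps)
  also have "\<dots> = Q powi s * (real q powi s * gauss_binomi (real q) (n - i) s
                              + gauss_binomi (real q) (n - i) (s - 1))"
    using \<open>Q \<noteq> 0\<close> by (simp add: step(3) Q_def power_int_diff algebra_simps)
  also have "\<dots> = Q powi s * gauss_binomi (real q) (Suc n - i) s"
    using gauss_binomi_Suc(1)[of "real q" "n - i" s] q step(1) by (simp add: Suc_diff_le)
  finally show ?case
    by (simp add: Q_def)
qed

lemma qbasis_coeff_gauss_binom:
  assumes "1 < q" "i \<le> n" "u \<le> n"
  shows "(\<Sum>j=0..n. qbasis_coeff q M n i j * gauss_binom (real q) (n - j) (n - u))
       = (real q powi M) ^ u * gauss_binom (real q) (n - i) u"
proof -
  have "(\<Sum>j=0..n. qbasis_coeff q M n i j * gauss_binom (real q) (n - j) (n - u))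
      = gauss_pairing (real q) (qbasis_coeff q M n i) n (int u)"
    unfolding gauss_pairing_def using assms(3)
    by (intro sum.cong) (auto simp: gauss_binomi_def nat_diff_distrib)
  with gauss_pairing_qbasis_coeff[OF assms(1,2)] show ?thesis
    by (simp add: gauss_binomi_def power_int_of_nat)
qed

lemma hc_qtransform_at:
  "j \<le> fst a \<Longrightarrow> hc (qtransform_at q a (Xpoly q) Ypoly) j M = (\<Sum>i=0..fst a. hc a i M * qbasis_coeff q M (fst a) i j)"
  by (simp add: qtransform_at_def hc_Pair qbasis_coeff_def)

lemma qbasis_coeff_inversion:
  fixes A B :: "nat \<Rightarrow> real"
  assumes q: "1 < q" and "c \<noteq> 0"
    and moments: "\<And>u. u \<le> n \<Longrightarrow> (real q powi M) ^ u * (\<Sum>i=0..n. A i * gauss_binom (real q) (n - i) u)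
                              = c * (\<Sum>j=0..n. B j * gauss_binom (real q) (n - j) (n - u))"
    and "j \<le> n"
  shows "B j = (\<Sum>i=0..n. A i * qbasis_coeff q M n i j) / c"
proof -
  define B' where "B' j = (\<Sum>i=0..n. A i * qbasis_coeff q M n i j) / c" for j
  have "(\<Sum>j=0..n. B' j * gauss_binom (real q) (n - j) (n - u))
      = (\<Sum>j=0..n. B j * gauss_binom (real q) (n - j) (n - u))" if "u \<le> n" for u
  proof -
    have "(\<Sum>j=0..n. B' j * gauss_binom (real q) (n - j) (n - u))
        = (\<Sum>i=0..n. A i * (\<Sum>j=0..n. qbasis_coeff q M n i j * gauss_binom (real q) (n - j) (n - u))) / c"
      unfolding B'_def sum_divide_distrib sum_distrib_left sum_distrib_right
      by (subst sum.swap) (simp add: mult.assoc)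
    also have "\<dots> = (real q powi M) ^ u * (\<Sum>i=0..n. A i * gauss_binom (real q) (n - i) u) / c"
      using q that by (simp add: qbasis_coeff_gauss_binom sum_distrib_left mult_ac)
    finally show ?thesis
      using moments[OF that] \<open>c \<noteq> 0\<close> by simp
  qed
  then have "B j - B' j = 0"
    using q \<open>j \<le> n\<close>
    by (intro gauss_binom_triangular_eq_0[where D = "\<lambda>j. B j - B' j" and q = "real q" and n = n])
       (simp_all add: left_diff_distrib sum_subtractf)
  then show ?thesis
    by (simp add: B'_def)
qed

lemma hc_rank_we: "j \<le> CARD('n) \<Longrightarrow> hc (rank_we F (D :: ('a::field ^ 'n) set)) j M = real (card {x\<in>D. rk F x = j})"
  by (simp add: hc_def rank_we_def)

lemma fst_rank_we [simp]: "fst (rank_we F (D :: ('a::field ^ 'n) set)) = CARD('n)"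
  by (simp add: rank_we_def)

lemma sum_eq_sum_card_fibres:
  fixes f :: "nat \<Rightarrow> real"
  assumes "finite D" "\<And>x. x \<in> D \<Longrightarrow> r x \<le> n"
  shows "(\<Sum>x\<in>D. f (r x)) = (\<Sum>i=0..n. real (card {x\<in>D. r x = i}) * f i)"
proof -
  have "(\<Sum>x\<in>D. f (r x)) = (\<Sum>i=0..n. \<Sum>x\<in>{x\<in>D. r x = i}. f (r x))"
    using assms by (intro sum.group[symmetric]) auto
  then show ?thesis
    by simp
qed

section \<open>Spans over a subfield\<close>

lemma
  assumes "is_subfield S"
  shows subfield_zero: "0 \<in> S"
    and subfield_one: "1 \<in> S"
    and subfield_add: "a \<in> S \<Longrightarrow> b \<in> S \<Longrightarrow> a + b \<in> S"
    and subfield_mult: "a \<in> S \<Longrightarrow> b \<in> S \<Longrightarrow> a * b \<in> S"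
    and subfield_uminus: "a \<in> S \<Longrightarrow> - a \<in> S"
    and subfield_inverse: "a \<in> S \<Longrightarrow> inverse a \<in> S"
    and subfield_diff: "a \<in> S \<Longrightarrow> b \<in> S \<Longrightarrow> a - b \<in> S"
    and subfield_divide: "a \<in> S \<Longrightarrow> b \<in> S \<Longrightarrow> a / b \<in> S"
  using assms unfolding is_subfield_def diff_conv_add_uminus divide_inverse by blast+

lemma subfield_sum:
  assumes "is_subfield S" "\<And>x. x \<in> A \<Longrightarrow> f x \<in> S"
  shows "sum f A \<in> S"
  using assms(2)
  by (induction A rule: infinite_finite_induct)
     (simp_all add: subfield_zero[OF assms(1)] subfield_add[OF assms(1)])

lemma subfield_UNIV: "is_subfield (UNIV :: 'a::field set)"
  by (simp add: is_subfield_def)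

lemma two_le_card_subfield:
  assumes "is_subfield S" "finite S"
  shows "2 \<le> card S"
proof -
  have "{0, 1} \<subseteq> S"
    using subfield_zero[OF assms(1)] subfield_one[OF assms(1)] by simp
  then have "card {0::'a, 1} \<le> card S"
    by (rule card_mono[OF assms(2)])
  then show ?thesis
    by simp
qed

text \<open>Spans of lists rather than of sets: a list is linearly independent over a finite \<open>S\<close>
  iff its span has the maximal size \<open>card S ^ length vs\<close>.\<close>

definition lspan :: "('a \<Rightarrow> 'b \<Rightarrow> 'b::comm_monoid_add) \<Rightarrow> 'a set \<Rightarrow> 'b list \<Rightarrow> 'b set" where
  "lspan sc S vs = {\<Sum>j<length vs. sc (c j) (vs ! j) | c. \<forall>j. c j \<in> S}"

lemma lspanI: "\<forall>j. c j \<in> S \<Longrightarrow> x = (\<Sum>j<length vs. sc (c j) (vs ! j)) \<Longrightarrow> x \<in> lspan sc S vs"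
  unfolding lspan_def by blast

lemma lspanE:
  assumes "x \<in> lspan sc S vs"
  obtains c where "\<forall>j. c j \<in> S" "x = (\<Sum>j<length vs. sc (c j) (vs ! j))"
  using assms unfolding lspan_def by blast

context vector_space
begin

lemma lspan_Cons: "lspan scale S (v # vs) = {scale a v + w | a w. a \<in> S \<and> w \<in> lspan scale S vs}"
proof (intro set_eqI iffI)
  fix x
  assume "x \<in> lspan scale S (v # vs)"
  then obtain c where c: "\<forall>j. c j \<in> S" "x = (\<Sum>j<length (v # vs). scale (c j) ((v # vs) ! j))"
    by (rule lspanE)
  then have "x = scale (c 0) v + (\<Sum>j<length vs. scale (c (Suc j)) (vs ! j))"
    unfolding length_Cons sum.lessThan_Suc_shift by simp
  moreover have "(\<Sum>j<length vs. scale (c (Suc j)) (vs ! j)) \<in> lspan scale S vs"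
    using c(1) by (intro lspanI) simp_all
  ultimately show "x \<in> {scale a v + w | a w. a \<in> S \<and> w \<in> lspan scale S vs}"
    using c(1) by blast
next
  fix x
  assume "x \<in> {scale a v + w | a w. a \<in> S \<and> w \<in> lspan scale S vs}"
  then obtain a c where "a \<in> S" "\<forall>j. c j \<in> S" "x = scale a v + (\<Sum>j<length vs. scale (c j) (vs ! j))"
    by (auto elim: lspanE)
  then show "x \<in> lspan scale S (v # vs)"
    by (intro lspanI[where c = "\<lambda>j. if j = 0 then a else c (j - 1)"])
       (simp_all add: sum.lessThan_Suc_shift del: sum.lessThan_Suc)
qed

context
  fixes S :: "'a set"
  assumes S: "is_subfield S"
begin

lemma lspan_Nil: "lspan scale S [] = {0}"
  using subfield_zero[OF S] by (auto simp: lspan_def)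

lemma lspan_zero: "0 \<in> lspan scale S vs"
  using subfield_zero[OF S] unfolding lspan_def by (auto intro!: exI[of _ "\<lambda>_. 0"])

lemma lspan_add: "x \<in> lspan scale S vs \<Longrightarrow> y \<in> lspan scale S vs \<Longrightarrow> x + y \<in> lspan scale S vs"
proof -
  assume "x \<in> lspan scale S vs" "y \<in> lspan scale S vs"
  then obtain c d where "\<forall>j. c j \<in> S" "\<forall>j. d j \<in> S"
    "x = (\<Sum>j<length vs. scale (c j) (vs ! j))" "y = (\<Sum>j<length vs. scale (d j) (vs ! j))"
    by (elim lspanE)
  then show ?thesis
    by (intro lspanI[where c = "\<lambda>j. c j + d j"])
       (simp_all add: subfield_add[OF S] scale_left_distrib sum.distrib)
qed

lemma lspan_scale: "a \<in> S \<Longrightarrow> x \<in> lspan scale S vs \<Longrightarrow> scale a x \<in> lspan scale S vs"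
proof -
  assume "a \<in> S" "x \<in> lspan scale S vs"
  then obtain c where "\<forall>j. c j \<in> S" "x = (\<Sum>j<length vs. scale (c j) (vs ! j))"
    by (elim lspanE)
  with \<open>a \<in> S\<close> show ?thesis
    by (intro lspanI[where c = "\<lambda>j. a * c j"]) (simp_all add: subfield_mult[OF S] scale_sum_right)
qed

lemma lspan_uminus: "x \<in> lspan scale S vs \<Longrightarrow> - x \<in> lspan scale S vs"
  using lspan_scale[of "-1" x vs] subfield_one[OF S] subfield_uminus[OF S] by simp

lemma lspan_diff: "x \<in> lspan scale S vs \<Longrightarrow> y \<in> lspan scale S vs \<Longrightarrow> x - y \<in> lspan scale S vs"
  using lspan_add[of x vs "- y"] lspan_uminus[of y vs] by simp

lemma lspan_sum: "(\<And>x. x \<in> A \<Longrightarrow> f x \<in> lspan scale S vs) \<Longrightarrow> sum f A \<in> lspan scale S vs"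
  by (induction A rule: infinite_finite_induct) (simp_all add: lspan_zero lspan_add)

lemma set_subset_lspan: "set vs \<subseteq> lspan scale S vs"
proof
  fix v
  assume "v \<in> set vs"
  then obtain k where k: "k < length vs" "vs ! k = v"
    by (auto simp: in_set_conv_nth)
  have "(\<Sum>j<length vs. scale (if j = k then 1 else 0) (vs ! j)) = (\<Sum>j<length vs. if j = k then v else 0)"
    using k by (intro sum.cong) auto
  with k show "v \<in> lspan scale S vs"
    using subfield_zero[OF S] subfield_one[OF S]
    by (intro lspanI[where c = "\<lambda>j. if j = k then 1 else 0"]) simp_all
qed

lemma lspan_minimal:
  assumes "0 \<in> V" "\<And>x y. x \<in> V \<Longrightarrow> y \<in> V \<Longrightarrow> x + y \<in> V"
    "\<And>a x. a \<in> S \<Longrightarrow> x \<in> V \<Longrightarrow> scale a x \<in> V" and "set vs \<subseteq> V"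
  shows "lspan scale S vs \<subseteq> V"
proof
  fix x
  assume "x \<in> lspan scale S vs"
  then obtain c where c: "\<forall>j. c j \<in> S" "x = (\<Sum>j<length vs. scale (c j) (vs ! j))"
    unfolding lspan_def by blast
  have "(\<Sum>j<k. scale (c j) (vs ! j)) \<in> V" if "k \<le> length vs" for k
    using that
  proof (induction k)
    case (Suc k)
    then show ?case
      using assms c(1) by (simp add: subset_code(1))
  qed (simp add: assms(1))
  then show "x \<in> V"
    using c by simp
qed

lemma lspan_Cons_absorb: "v \<in> lspan scale S vs \<Longrightarrow> lspan scale S (v # vs) = lspan scale S vs"
proof
  assume "v \<in> lspan scale S vs"
  then show "lspan scale S (v # vs) \<subseteq> lspan scale S vs"
    unfolding lspan_Cons by (auto intro: lspan_add lspan_scale)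
  show "lspan scale S vs \<subseteq> lspan scale S (v # vs)"
    unfolding lspan_Cons using subfield_zero[OF S] by force
qed

lemma card_lspan_Cons:
  assumes "finite (UNIV :: 'b set)" "finite S" and v: "v \<notin> lspan scale S vs"
  shows "card (lspan scale S (v # vs)) = card S * card (lspan scale S vs)"
proof -
  define g where "g p = scale (fst p) v + snd p" for p
  have "lspan scale S (v # vs) = g ` (S \<times> lspan scale S vs)"
    unfolding lspan_Cons g_def by force
  moreover have "inj_on g (S \<times> lspan scale S vs)"
  proof (rule inj_onI, clarify)
    fix a w a' w'
    assume a: "a \<in> S" "w \<in> lspan scale S vs" "a' \<in> S" "w' \<in> lspan scale S vs"
      and "g (a, w) = g (a', w')"
    then have e: "scale (a - a') v = w' - w"
      by (simp add: g_def algebra_simps scale_left_diff_distrib)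
    show "a = a' \<and> w = w'"
    proof (rule ccontr)
      assume "\<not> (a = a' \<and> w = w')"
      with e have "a \<noteq> a'"
        by auto
      from e have "scale (inverse (a - a')) (scale (a - a') v) = scale (inverse (a - a')) (w' - w)"
        by simp
      with \<open>a \<noteq> a'\<close> have "v = scale (inverse (a - a')) (w' - w)"
        by simp
      moreover have "inverse (a - a') \<in> S"
        using a subfield_diff[OF S] subfield_inverse[OF S] by blast
      ultimately have "v \<in> lspan scale S vs"
        using a by (simp add: lspan_scale lspan_diff)
      with v show False ..
    qed
  qed
  moreover have "finite (lspan scale S vs)"
    using assms(1) by (rule finite_subset[rotated]) simp
  ultimately show ?thesis
    using assms(2) by (simp add: card_image card_cartesian_product)
qed

lemma card_lspan_le:
  assumes "finite (UNIV :: 'b set)" "finite S"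
  shows "card (lspan scale S vs) \<le> card S ^ length vs"
proof (induction vs)
  case Nil
  then show ?case
    by (simp add: lspan_Nil)
next
  case (Cons v vs)
  have "1 \<le> card S"
    using two_le_card_subfield[OF S assms(2)] by simp
  show ?case
  proof (cases "v \<in> lspan scale S vs")
    case True
    then have "card (lspan scale S (v # vs)) = card (lspan scale S vs)"
      by (simp add: lspan_Cons_absorb)
    also have "\<dots> \<le> card S ^ length vs"
      by (rule Cons)
    also have "\<dots> \<le> card S ^ length (v # vs)"
      using \<open>1 \<le> card S\<close> by (intro power_increasing) simp_all
    finally show ?thesis .
  next
    case False
    then show ?thesis
      using Cons by (simp add: card_lspan_Cons[OF assms])
  qed
qed

lemma ex_independent_sublist:
  assumes "finite (UNIV :: 'b set)" "finite S"
  shows "\<exists>ws. set ws \<subseteq> set vs \<and> distinct ws \<and> lspan scale S ws = lspan scale S vs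
              \<and> card (lspan scale S ws) = card S ^ length ws"
proof (induction vs)
  case Nil
  then show ?case
    by (intro exI[of _ "[]"]) (simp add: lspan_Nil)
next
  case (Cons v vs)
  then obtain ws where ws: "set ws \<subseteq> set vs" "distinct ws" "lspan scale S ws = lspan scale S vs"
    "card (lspan scale S ws) = card S ^ length ws"
    by blast
  show ?case
  proof (cases "v \<in> lspan scale S vs")
    case True
    then show ?thesis
      using ws by (intro exI[of _ ws]) (auto simp: lspan_Cons_absorb)
  next
    case False
    then have "v \<notin> set ws"
      using ws(3) set_subset_lspan[of ws] by auto
    moreover have "lspan scale S (v # ws) = lspan scale S (v # vs)"
      using ws(3) by (simp only: lspan_Cons)
    moreover have "card (lspan scale S (v # ws)) = card S ^ length (v # ws)"
      using False ws by (simp add: card_lspan_Cons[OF assms])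
    ultimately show ?thesis
      using ws by (intro exI[of _ "v # ws"]) auto
  qed
qed

lemma lspan_eq_image:
  "lspan scale S vs = (\<lambda>c. \<Sum>j<length vs. scale (c j) (vs ! j)) ` (PiE {..<length vs} (\<lambda>_. S))"
proof (intro set_eqI iffI)
  fix x
  assume "x \<in> lspan scale S vs"
  then obtain c where c: "\<forall>j. c j \<in> S" "x = (\<Sum>j<length vs. scale (c j) (vs ! j))"
    unfolding lspan_def by blast
  then have "restrict c {..<length vs} \<in> PiE {..<length vs} (\<lambda>_. S)"
    "x = (\<Sum>j<length vs. scale (restrict c {..<length vs} j) (vs ! j))"
    by auto
  then show "x \<in> (\<lambda>c. \<Sum>j<length vs. scale (c j) (vs ! j)) ` (PiE {..<length vs} (\<lambda>_. S))"
    by blast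
next
  fix x
  assume "x \<in> (\<lambda>c. \<Sum>j<length vs. scale (c j) (vs ! j)) ` (PiE {..<length vs} (\<lambda>_. S))"
  then obtain c where c: "c \<in> PiE {..<length vs} (\<lambda>_. S)" "x = (\<Sum>j<length vs. scale (c j) (vs ! j))"
    by blast
  define d where "d j = (if j < length vs then c j else 0)" for j
  have "\<forall>j. d j \<in> S" "x = (\<Sum>j<length vs. scale (d j) (vs ! j))"
    using c subfield_zero[OF S] by (auto simp: d_def)
  then show "x \<in> lspan scale S vs"
    unfolding lspan_def by blast
qed

lemma inj_on_lspan_coefficients:
  assumes "finite S" "card (lspan scale S vs) = card S ^ length vs"
  shows "inj_on (\<lambda>c. \<Sum>j<length vs. scale (c j) (vs ! j)) (PiE {..<length vs} (\<lambda>_. S))"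
  using assms by (intro eq_card_imp_inj_on) (simp_all add: finite_PiE card_PiE flip: lspan_eq_image)

end

end

lemma Fspan_subset_lspan:
  assumes F: "is_subfield F" and "set vs = A"
  shows "Fspan F A \<subseteq> lspan (*) F vs"
proof
  fix x
  assume "x \<in> Fspan F A"
  then obtain T c where "T \<subseteq> A" "\<forall>s. c s \<in> F" "x = (\<Sum>s\<in>T. c s * s)"
    unfolding Fspan_def by blast
  have "c s * s \<in> lspan (*) F vs" if "s \<in> T" for s
  proof -
    have "s \<in> lspan (*) F vs"
      using that \<open>T \<subseteq> A\<close> assms vector_space_over_itself.set_subset_lspan[OF F, of vs] by blast
    with \<open>\<forall>s. c s \<in> F\<close> show ?thesis
      by (simp add: vector_space_over_itself.lspan_scale[OF F])
  qed
  then have "(\<Sum>s\<in>T. c s * s) \<in> lspan (*) F vs"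
    by (rule vector_space_over_itself.lspan_sum[OF F])
  with \<open>x = (\<Sum>s\<in>T. c s * s)\<close> show "x \<in> lspan (*) F vs"
    by simp
qed

lemma lspan_subset_Fspan:
  assumes F: "is_subfield F" and "set vs = A"
  shows "lspan (*) F vs \<subseteq> Fspan F A"
proof
  fix x
  assume "x \<in> lspan (*) F vs"
  then obtain c where c: "\<forall>j. c j \<in> F" "x = (\<Sum>j<length vs. c j * vs ! j)"
    by (rule lspanE)
  define d where "d s = (\<Sum>j\<in>{j\<in>{..<length vs}. vs ! j = s}. c j)" for s
  have "(\<Sum>s\<in>set vs. d s * s) = (\<Sum>s\<in>set vs. \<Sum>j\<in>{j\<in>{..<length vs}. vs ! j = s}. c j * vs ! j)"
    unfolding d_def sum_distrib_right by (intro sum.cong refl) simp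
  also have "\<dots> = x"
    unfolding c(2) by (rule sum.group) (auto simp: image_subset_iff)
  finally have "x = (\<Sum>s\<in>set vs. d s * s)" ..
  moreover have "\<forall>s. d s \<in> F"
    unfolding d_def using c(1) by (auto intro: subfield_sum[OF F])
  ultimately show "x \<in> Fspan F A"
    unfolding Fspan_def using assms by (intro CollectI exI[of _ "set vs"] exI[of _ d]) auto
qed

lemma Fspan_eq_lspan:
  assumes "is_subfield F" "set vs = A"
  shows "Fspan F A = lspan (*) F vs"
  using Fspan_subset_lspan[OF assms] lspan_subset_Fspan[OF assms] by (rule equalityI)

section \<open>Orthogonality over a subfield\<close>

text \<open>Vectors over a subfield \<open>S\<close> are modelled inside \<open>'a ^ 'n\<close> as the vectors with all
  coordinates in \<open>S\<close>.\<close>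

definition fvecs :: "'a::field set \<Rightarrow> ('a ^ 'n) set" where
  "fvecs S = {u. \<forall>i. u $ i \<in> S}"

definition dot :: "'a::field ^ 'n \<Rightarrow> 'a ^ 'n \<Rightarrow> 'a" where
  "dot u v = (\<Sum>i\<in>UNIV. u $ i * v $ i)"

definition fsubspace :: "'a::field set \<Rightarrow> ('a ^ 'n) set \<Rightarrow> bool" where
  "fsubspace S U \<longleftrightarrow> U \<subseteq> fvecs S \<and> 0 \<in> U \<and> (\<forall>x\<in>U. \<forall>y\<in>U. x + y \<in> U) \<and> (\<forall>c\<in>S. \<forall>x\<in>U. c *s x \<in> U)"

definition orth :: "'a::field set \<Rightarrow> ('a ^ 'n) set \<Rightarrow> ('a ^ 'n) set" where
  "orth S U = {u \<in> fvecs S. \<forall>v\<in>U. dot u v = 0}"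

lemma dot_commute: "dot u v = dot v u"
  by (simp add: dot_def mult.commute)

lemma dot_add_left: "dot (x + y) v = dot x v + dot y v"
  by (simp add: dot_def algebra_simps sum.distrib)

lemma dot_add_right: "dot v (x + y) = dot v x + dot v y"
  by (simp add: dot_def algebra_simps sum.distrib)

lemma dot_scale_left: "dot (c *s x) v = c * dot x v"
  by (simp add: dot_def sum_distrib_left algebra_simps)

lemma dot_scale_right: "dot v (c *s x) = c * dot v x"
  by (simp add: dot_def sum_distrib_left algebra_simps)

lemma dot_zero_left [simp]: "dot 0 v = 0"
  by (simp add: dot_def)

lemma dot_zero_right [simp]: "dot v 0 = 0"
  by (simp add: dot_def)

lemma dot_axis_left: "dot (axis i 1) v = v $ i"
proof -
  have "dot (axis i 1) v = (\<Sum>j\<in>UNIV. if j = i then v $ i else 0)"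
    unfolding dot_def by (rule sum.cong) (auto simp: axis_def)
  then show ?thesis
    by simp
qed

lemma fvecs_UNIV [simp]: "fvecs UNIV = UNIV"
  by (simp add: fvecs_def)

lemma card_fvecs: "card (fvecs S :: ('a::field ^ 'n) set) = card S ^ CARD('n)"
proof -
  have "bij_betw vec_nth (fvecs S :: ('a ^ 'n) set) (PiE UNIV (\<lambda>_. S))"
    by (rule bij_betwI[where g = vec_lambda]) (auto simp: fvecs_def)
  then show ?thesis
    by (simp add: bij_betw_same_card card_PiE)
qed

lemma orth_subset_fvecs: "orth S U \<subseteq> fvecs S"
  by (auto simp: orth_def)

lemma orth_antimono: "A \<subseteq> B \<Longrightarrow> orth S B \<subseteq> orth S A"
  by (auto simp: orth_def)

context
  fixes S :: "'a::field set"
  assumes S: "is_subfield S"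
begin

lemma dot_in_subfield: "u \<in> fvecs S \<Longrightarrow> v \<in> fvecs S \<Longrightarrow> dot u v \<in> S"
  unfolding dot_def fvecs_def by (auto intro!: subfield_sum[OF S] subfield_mult[OF S])

lemma
  shows fvecs_zero: "0 \<in> fvecs S"
    and fvecs_add: "x \<in> fvecs S \<Longrightarrow> y \<in> fvecs S \<Longrightarrow> x + y \<in> fvecs S"
    and fvecs_scale: "c \<in> S \<Longrightarrow> x \<in> fvecs S \<Longrightarrow> c *s x \<in> fvecs S"
    and axis_in_fvecs: "axis i 1 \<in> fvecs S"
  using S by (auto simp: fvecs_def axis_def subfield_zero subfield_one subfield_add subfield_mult)

lemma fsubspace_fvecs: "fsubspace S (fvecs S)"
  by (simp add: fsubspace_def fvecs_zero fvecs_add fvecs_scale)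

lemma fsubspace_diff: "fsubspace S U \<Longrightarrow> x \<in> U \<Longrightarrow> y \<in> U \<Longrightarrow> x - y \<in> U"
  unfolding fsubspace_def
  using subfield_one[OF S] subfield_uminus[OF S] by (metis diff_conv_add_uminus vector_sneg_minus1)

lemma fsubspace_orth: "fsubspace S (orth S U)"
  unfolding fsubspace_def orth_def
  by (auto simp: fvecs_zero fvecs_add fvecs_scale dot_add_left dot_scale_left)

end

lemma card_eq_card_mult_card_fibre:
  assumes "finite A" "g ` A \<subseteq> B" "finite B" "\<And>b. b \<in> B \<Longrightarrow> card {a\<in>A. g a = b} = k"
  shows "card A = card B * k"
proof -
  have "A = (\<Union>b\<in>B. {a\<in>A. g a = b})"
    using assms(2) by auto
  also have "card \<dots> = (\<Sum>b\<in>B. card {a\<in>A. g a = b})"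
    using assms(1,3) by (intro card_UN_disjoint) auto
  finally have "card A = (\<Sum>b\<in>B. card {a\<in>A. g a = b})" .
  then show ?thesis
    using assms(4) by simp
qed

lemma card_eq_card_image_mult_card_kernel:
  fixes f :: "'v::ab_group_add \<Rightarrow> 'w::ab_group_add"
  assumes "finite V"
    and add: "\<And>x y. x \<in> V \<Longrightarrow> y \<in> V \<Longrightarrow> x + y \<in> V"
    and diff: "\<And>x y. x \<in> V \<Longrightarrow> y \<in> V \<Longrightarrow> x - y \<in> V"
    and hom: "\<And>x y. x \<in> V \<Longrightarrow> y \<in> V \<Longrightarrow> f (x + y) = f x + f y"
  shows "card V = card (f ` V) * card {v\<in>V. f v = 0}"
proof (rule card_eq_card_mult_card_fibre[OF assms(1) subset_refl])
  show "finite (f ` V)"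
    using assms(1) by simp
  fix b
  assume "b \<in> f ` V"
  then obtain x0 where x0: "x0 \<in> V" "f x0 = b"
    by blast
  have "bij_betw (\<lambda>w. x0 + w) {v\<in>V. f v = 0} {a\<in>V. f a = b}"
  proof (rule bij_betwI[where g = "\<lambda>v. v - x0"])
    show "(\<lambda>w. x0 + w) \<in> {v\<in>V. f v = 0} \<rightarrow> {a\<in>V. f a = b}"
      using x0 add hom by auto
    show "(\<lambda>v. v - x0) \<in> {a\<in>V. f a = b} \<rightarrow> {v\<in>V. f v = 0}"
    proof
      fix v
      assume v: "v \<in> {a\<in>V. f a = b}"
      then have "v - x0 \<in> V"
        using diff x0 by auto
      moreover have "f v = f x0 + f (v - x0)"
        using hom[OF x0(1) \<open>v - x0 \<in> V\<close>] by simp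
      ultimately show "v - x0 \<in> {v\<in>V. f v = 0}"
        using v x0 by simp
    qed
  qed auto
  then have "card {v\<in>V. f v = 0} = card {a\<in>V. f a = b}"
    by (rule bij_betw_same_card)
  then show "card {a\<in>V. f a = b} = card {v\<in>V. f v = 0}"
    by simp
qed

lemma card_eq_card_subfield_mult_card_kernel:
  fixes V :: "('a::{field,finite} ^ 'n) set" and f :: "'a ^ 'n \<Rightarrow> 'a"
  assumes S: "is_subfield S" and V: "fsubspace S V"
    and add: "\<And>x y. x \<in> V \<Longrightarrow> y \<in> V \<Longrightarrow> f (x + y) = f x + f y"
    and scale: "\<And>c x. c \<in> S \<Longrightarrow> x \<in> V \<Longrightarrow> f (c *s x) = c * f x"
    and "f ` V \<subseteq> S" and w: "w \<in> V" "f w \<noteq> 0"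
  shows "card V = card S * card {v\<in>V. f v = 0}"
proof -
  have "S \<subseteq> f ` V"
  proof
    fix c
    assume "c \<in> S"
    then have "c / f w \<in> S"
      using \<open>f ` V \<subseteq> S\<close> w subfield_divide[OF S] by blast
    then have "(c / f w) *s w \<in> V" "f ((c / f w) *s w) = c"
      using V w scale unfolding fsubspace_def by auto
    then show "c \<in> f ` V"
      by (metis image_eqI)
  qed
  with \<open>f ` V \<subseteq> S\<close> have "f ` V = S"
    by blast
  with V show ?thesis
    using card_eq_card_image_mult_card_kernel[of V f] fsubspace_diff[OF S V] add
    by (simp add: fsubspace_def)
qed

context
  fixes S :: "'a::{field,finite} set" and V :: "('a ^ 'n) set"
  assumes S: "is_subfield S" and V: "fsubspace S V"
begin

lemma card_dot_kernel_left:
  assumes "u \<in> fvecs S"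
  shows "card S * card {v\<in>V. dot u v = 0} = (if u \<in> orth S V then card S * card V else card V)"
proof (cases "u \<in> orth S V")
  case True
  then have "{v\<in>V. dot u v = 0} = V"
    by (auto simp: orth_def)
  with True show ?thesis
    by simp
next
  case False
  with assms obtain v0 where "v0 \<in> V" "dot u v0 \<noteq> 0"
    by (auto simp: orth_def)
  moreover have "dot u ` V \<subseteq> S"
    using V assms dot_in_subfield[OF S] by (auto simp: fsubspace_def)
  ultimately have "card V = card S * card {v\<in>V. dot u v = 0}"
    by (intro card_eq_card_subfield_mult_card_kernel[OF S V])
       (simp_all add: dot_add_right dot_scale_right)
  with False show ?thesis
    by simp
qed

lemma card_dot_kernel_right:
  fixes v :: "'a ^ 'n"
  assumes "v \<in> fvecs S"
  shows "card S * card {u\<in>fvecs S. dot u v = 0}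
           = (if v = 0 then card S * card (fvecs S :: ('a ^ 'n) set) else card (fvecs S :: ('a ^ 'n) set))"
proof (cases "v = 0")
  case False
  then obtain i where "v $ i \<noteq> 0"
    by (metis vec_eq_iff zero_index)
  moreover have "(\<lambda>u. dot u v) ` fvecs S \<subseteq> S"
    using assms dot_in_subfield[OF S] by auto
  ultimately have "card (fvecs S :: ('a ^ 'n) set) = card S * card {u\<in>fvecs S. dot u v = 0}"
    by (intro card_eq_card_subfield_mult_card_kernel[OF S fsubspace_fvecs[OF S],
          where f = "\<lambda>u. dot u v" and w = "axis i 1"])
       (simp_all add: dot_add_left dot_scale_left dot_axis_left axis_in_fvecs[OF S])
  with False show ?thesis
    by simp
qed simp

text \<open>Double counting of the pairs \<open>(u, v)\<close> with \<open>u \<in> fvecs S\<close>, \<open>v \<in> V\<close> and \<open>dot u v = 0\<close>.\<close>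

lemma card_mult_card_orth: "card V * card (orth S V) = card S ^ CARD('n)"
proof -
  define N where "N = card (fvecs S :: ('a ^ 'n) set)"
  define c where "c = card V"
  define p where "p = card (orth S V)"
  define s where "s = card S"
  have VS: "V \<subseteq> fvecs S" "0 \<in> V"
    using V by (simp_all add: fsubspace_def)
  have "s * (\<Sum>v\<in>V. card {u\<in>fvecs S. dot u v = 0}) = (\<Sum>v\<in>V. if v = 0 then s * N else N)"
    unfolding sum_distrib_left using VS(1)
    by (intro sum.cong refl) (auto simp: card_dot_kernel_right[OF subsetD[OF VS(1)]] N_def s_def)
  also have "\<dots> = s * N + (c - 1) * N"
    using VS by (simp add: sum.If_cases c_def Int_absorb1 Diff_eq[symmetric])
  finally have L: "s * (\<Sum>v\<in>V. card {u\<in>fvecs S. dot u v = 0}) = s * N + (c - 1) * N" .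
  have "s * (\<Sum>u\<in>fvecs S. card {v\<in>V. dot u v = 0}) = (\<Sum>u\<in>fvecs S. if u \<in> orth S V then s * c else c)"
    unfolding sum_distrib_left c_def s_def by (intro sum.cong refl) (simp add: card_dot_kernel_left)
  also have "\<dots> = p * (s * c) + (N - p) * c"
    using orth_subset_fvecs[of S V]
    by (simp add: sum.If_cases p_def N_def Int_absorb1 Diff_eq[symmetric] card_Diff_subset)
  finally have R: "s * (\<Sum>u\<in>fvecs S. card {v\<in>V. dot u v = 0}) = p * (s * c) + (N - p) * c" .
  have "(\<Sum>u\<in>fvecs S. card {v\<in>V. dot u v = 0}) = (\<Sum>v\<in>V. card {u\<in>fvecs S. dot u v = 0})"
    using sum.swap[where g = "\<lambda>u v. of_bool (dot u v = 0) :: nat" and A = "fvecs S" and B = V]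
    by (simp add: Collect_conj_eq)
  with L R have "s * N + (c - 1) * N = p * (s * c) + (N - p) * c"
    by simp
  moreover have "1 \<le> c" "p \<le> N" "2 \<le> s"
    using VS orth_subset_fvecs[of S V] two_le_card_subfield[OF S]
    by (auto simp: c_def p_def N_def s_def Suc_le_eq card_gt_0_iff intro: card_mono)
  ultimately have "int s * int N + (int c - 1) * int N = int p * (int s * int c) + (int N - int p) * int c"
    by (metis of_nat_add of_nat_diff of_nat_mult of_nat_1)
  then have "(int s - 1) * (int N - int p * int c) = 0"
    by (simp add: algebra_simps)
  with \<open>2 \<le> s\<close> have "N = p * c"
    by (simp add: flip: of_nat_mult)
  then show ?thesis
    by (simp add: N_def p_def c_def card_fvecs mult.commute)
qed

end

lemma orth_orth:
  fixes V :: "('a::{field,finite} ^ 'n) set"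
  assumes S: "is_subfield S" and V: "fsubspace S V"
  shows "orth S (orth S V) = V"
proof -
  have sub: "V \<subseteq> orth S (orth S V)"
    using V by (auto simp: orth_def fsubspace_def dot_commute)
  have "card V * card (orth S V) = card (orth S (orth S V)) * card (orth S V)"
    using card_mult_card_orth[OF S V] card_mult_card_orth[OF S fsubspace_orth[OF S, of V]]
    by (simp add: mult.commute)
  moreover have "orth S V \<noteq> {}"
    using fsubspace_orth[OF S, of V] by (auto simp: fsubspace_def)
  ultimately have "card V = card (orth S (orth S V))"
    by simp
  with card_subset_eq[OF _ sub] show ?thesis
    by simp
qed

lemma fsubspace_set_plus:
  assumes "fsubspace S A" "fsubspace S B" "is_subfield S"
  shows "fsubspace S (A + B)"
  unfolding fsubspace_def
proof (intro conjI ballI)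
  show "A + B \<subseteq> fvecs S"
    using assms by (auto simp: fsubspace_def elim!: set_plus_elim intro: fvecs_add)
  show "0 \<in> A + B"
    using assms set_plus_intro[of 0 A 0 B] by (simp add: fsubspace_def)
  fix x y
  assume "x \<in> A + B" "y \<in> A + B"
  then obtain a b a' b' where "a \<in> A" "b \<in> B" "a' \<in> A" "b' \<in> B" "x = a + b" "y = a' + b'"
    by (auto elim!: set_plus_elim)
  moreover have "a + a' \<in> A" "b + b' \<in> B"
    using assms calculation by (simp_all add: fsubspace_def)
  moreover have "(a + b) + (a' + b') = (a + a') + (b + b')"
    by (simp add: algebra_simps)
  ultimately show "x + y \<in> A + B"
    by (metis set_plus_intro)
next
  fix c x
  assume "c \<in> S" "x \<in> A + B"
  then show "c *s x \<in> A + B"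
    using assms by (auto simp: fsubspace_def vector_add_ldistrib elim!: set_plus_elim intro!: set_plus_intro)
qed

lemma card_set_plus_mult_card_inter:
  fixes A B :: "('a::{field,finite} ^ 'n) set"
  assumes S: "is_subfield S" and A: "fsubspace S A" and B: "fsubspace S B"
  shows "card (A + B) * card (A \<inter> B) = card A * card B"
proof -
  have "card (A \<times> B) = card (A + B) * card (A \<inter> B)"
  proof (rule card_eq_card_mult_card_fibre[where g = "\<lambda>p. fst p + snd p"])
    show "(\<lambda>p. fst p + snd p) ` (A \<times> B) \<subseteq> A + B"
      by auto
    fix x
    assume "x \<in> A + B"
    then obtain a0 b0 where ab: "a0 \<in> A" "b0 \<in> B" "x = a0 + b0"
      by (auto elim: set_plus_elim)
    have "bij_betw (\<lambda>z. (a0 + z, b0 - z)) (A \<inter> B) {p \<in> A \<times> B. fst p + snd p = x}"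
    proof (rule bij_betwI[where g = "\<lambda>p. fst p - a0"])
      show "(\<lambda>z. (a0 + z, b0 - z)) \<in> A \<inter> B \<rightarrow> {p \<in> A \<times> B. fst p + snd p = x}"
        using ab A B fsubspace_diff[OF S B] by (auto simp: fsubspace_def)
      show "(\<lambda>p. fst p - a0) \<in> {p \<in> A \<times> B. fst p + snd p = x} \<rightarrow> A \<inter> B"
      proof (clarsimp)
        fix a b
        assume "a \<in> A" "b \<in> B" "x = a + b"
        then have "a - a0 = b0 - b"
          using ab by (simp add: algebra_simps)
        then show "a - a0 \<in> A \<and> a - a0 \<in> B"
          using fsubspace_diff[OF S A] fsubspace_diff[OF S B] ab \<open>a \<in> A\<close> \<open>b \<in> B\<close> by metis
      qed
    qed (auto simp: ab algebra_simps prod_eq_iff)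
    then show "card {p \<in> A \<times> B. fst p + snd p = x} = card (A \<inter> B)"
      by (simp add: bij_betw_same_card)
  qed simp_all
  then show ?thesis
    by (simp add: card_cartesian_product)
qed

lemma orth_set_plus:
  assumes "0 \<in> A" "0 \<in> B"
  shows "orth S (A + B) = orth S A \<inter> orth S B"
proof
  have "A \<subseteq> A + B"
    using set_zero_plus2[OF assms(2), of A] by (simp add: add.commute)
  moreover have "B \<subseteq> A + B"
    by (rule set_zero_plus2[OF assms(1)])
  ultimately show "orth S (A + B) \<subseteq> orth S A \<inter> orth S B"
    using orth_antimono by blast
  show "orth S A \<inter> orth S B \<subseteq> orth S (A + B)"
    by (auto simp: orth_def dot_add_right elim!: set_plus_elim)
qed

lemma card_inter_mult_card_orth:
  fixes C W :: "('a::{field,finite} ^ 'n) set"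
  assumes S: "is_subfield S" and C: "fsubspace S C" and W: "fsubspace S W"
  shows "card (C \<inter> W) * card (orth S W) = card C * card (orth S C \<inter> orth S W)"
proof -
  define X where "X = orth S C + orth S W"
  have X: "fsubspace S X"
    unfolding X_def by (intro fsubspace_set_plus fsubspace_orth S)
  have "orth S X = C \<inter> W"
    using orth_set_plus orth_orth[OF S C] orth_orth[OF S W] fsubspace_orth[OF S]
    unfolding X_def fsubspace_def by metis
  then have e1: "card (C \<inter> W) * card X = card S ^ CARD('n)"
    using card_mult_card_orth[OF S X] by (simp add: mult.commute)
  have e2: "card C * card (orth S C) = card S ^ CARD('n)"
    by (rule card_mult_card_orth[OF S C])
  have e3: "card X * card (orth S C \<inter> orth S W) = card (orth S C) * card (orth S W)"
    unfolding X_def by (rule card_set_plus_mult_card_inter[OF S fsubspace_orth[OF S] fsubspace_orth[OF S]])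
  have "card (C \<inter> W) * card (orth S W) * (card X * card (orth S C))
      = (card (C \<inter> W) * card X) * (card (orth S C) * card (orth S W))"
    by (simp add: ac_simps)
  also have "\<dots> = card C * card (orth S C \<inter> orth S W) * (card X * card (orth S C))"
    by (simp add: e1 e2 flip: e3)
  finally have "card (C \<inter> W) * card (orth S W) * (card X * card (orth S C))
      = card C * card (orth S C \<inter> orth S W) * (card X * card (orth S C))" .
  moreover have "X \<noteq> {}" "orth S C \<noteq> {}"
    using X fsubspace_orth[OF S, of C] by (auto simp: fsubspace_def)
  ultimately show ?thesis
    by simp
qed

lemma dual_code_eq_orth: "dual_code C = orth UNIV C"
  by (simp add: dual_code_def orth_def dot_def)

lemma fsubspace_UNIV_iff: "fsubspace UNIV C \<longleftrightarrow> vec.subspace C"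
  by (simp add: fsubspace_def vec.subspace_def)

section \<open>Coordinates with respect to a basis over the subfield\<close>

locale gf_subfield =
  fixes F :: "'a::{field,finite} set" and q m :: nat
  assumes subfield: "is_subfield F" and card_F: "card F = q" and CARD_field: "CARD('a) = q ^ m"
begin

lemma two_le_q: "2 \<le> q"
  using two_le_card_subfield[OF subfield] card_F by simp

lemma ex_basis: "\<exists>e::'a list. length e = m \<and> lspan (*) F e = UNIV \<and> card (lspan (*) F e) = q ^ m"
proof -
  obtain vs :: "'a list" where vs: "set vs = UNIV"
    using finite_list[of "UNIV :: 'a set"] by auto
  obtain ws where ws: "lspan (*) F ws = lspan (*) F vs" "card (lspan (*) F ws) = q ^ length ws"
    using vector_space_over_itself.ex_independent_sublist[OF subfield, of vs] card_F by auto
  have "lspan (*) F ws = UNIV"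
    using ws(1) vs vector_space_over_itself.set_subset_lspan[OF subfield, of vs] by auto
  with ws(2) have "q ^ length ws = q ^ m"
    by (simp add: CARD_field)
  then have "length ws = m"
    using two_le_q by (simp add: power_inject_exp)
  with ws(2) \<open>lspan (*) F ws = UNIV\<close> show ?thesis
    by auto
qed

definition basis :: "'a list" where
  "basis = (SOME e. length e = m \<and> lspan (*) F e = UNIV \<and> card (lspan (*) F e) = q ^ m)"

lemma
  shows length_basis: "length basis = m"
    and lspan_basis: "lspan (*) F basis = UNIV"
    and card_lspan_basis: "card (lspan (*) F basis) = q ^ m"
  using someI_ex[OF ex_basis] unfolding basis_def by auto

definition combine :: "(nat \<Rightarrow> 'a) \<Rightarrow> 'a" where
  "combine c = (\<Sum>t<m. c t * basis ! t)"

definition coeffs :: "(nat \<Rightarrow> 'a) set" where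
  "coeffs = PiE {..<m} (\<lambda>_. F)"

lemma bij_betw_combine: "bij_betw combine coeffs UNIV"
  unfolding bij_betw_def combine_def coeffs_def
  using vector_space_over_itself.inj_on_lspan_coefficients[OF subfield, of basis]
    vector_space_over_itself.lspan_eq_image[OF subfield, of basis]
  by (simp add: length_basis lspan_basis card_lspan_basis card_F CARD_field)

definition coords :: "'a \<Rightarrow> nat \<Rightarrow> 'a" where
  "coords = the_inv_into coeffs combine"

lemma coords_in_coeffs: "coords z \<in> coeffs"
  unfolding coords_def using bij_betw_combine by (auto simp: bij_betw_def intro: the_inv_into_into)

lemma combine_coords [simp]: "combine (coords z) = z"
  unfolding coords_def using bij_betw_combine by (simp add: bij_betw_def f_the_inv_into_f)

lemma coords_combine: "c \<in> coeffs \<Longrightarrow> coords (combine c) = c"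
  unfolding coords_def using bij_betw_combine by (simp add: bij_betw_def the_inv_into_f_f)

lemma coords_in_subfield: "t < m \<Longrightarrow> coords z t \<in> F"
  using coords_in_coeffs[of z] by (auto simp: coeffs_def)

lemma coords_eq_undefined: "\<not> t < m \<Longrightarrow> coords z t = undefined"
  using coords_in_coeffs[of z] by (auto simp: coeffs_def PiE_def extensional_def)

definition coord_vec :: "'a ^ 'n \<Rightarrow> nat \<Rightarrow> 'a ^ 'n" where
  "coord_vec x t = (\<chi> i. coords (x $ i) t)"

lemma coord_vec_in_fvecs: "t < m \<Longrightarrow> coord_vec x t \<in> fvecs F"
  by (simp add: coord_vec_def fvecs_def coords_in_subfield)

lemma dot_eq_combine: "dot x l = combine (\<lambda>t\<in>{..<m}. dot (coord_vec x t) l)"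
proof -
  have "combine (\<lambda>t\<in>{..<m}. dot (coord_vec x t) l) = (\<Sum>i\<in>UNIV. \<Sum>t<m. coords (x $ i) t * l $ i * basis ! t)"
    by (simp add: combine_def dot_def coord_vec_def sum_distrib_right sum.swap[where A = "{..<m}"])
  also have "\<dots> = (\<Sum>i\<in>UNIV. combine (coords (x $ i)) * l $ i)"
    by (simp add: combine_def sum_distrib_left sum_distrib_right mult_ac)
  finally show ?thesis
    by (simp add: dot_def)
qed

lemma dot_eq_0_iff_coord_vec:
  assumes "l \<in> fvecs F"
  shows "dot x l = 0 \<longleftrightarrow> (\<forall>t<m. dot (coord_vec x t) l = 0)"
proof -
  have "(\<lambda>t\<in>{..<m}. dot (coord_vec x t) l) \<in> coeffs" "(\<lambda>t\<in>{..<m}. 0) \<in> coeffs"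
    using dot_in_subfield[OF subfield coord_vec_in_fvecs assms] subfield_zero[OF subfield]
    by (auto simp: coeffs_def)
  moreover have "combine (\<lambda>t\<in>{..<m}. 0) = 0"
    by (simp add: combine_def)
  ultimately have "dot x l = 0 \<longleftrightarrow> (\<lambda>t\<in>{..<m}. dot (coord_vec x t) l) = (\<lambda>t\<in>{..<m}. 0)"
    using bij_betw_combine unfolding dot_eq_combine[of x l] bij_betw_def inj_on_def by metis
  then show ?thesis
    by (auto simp: fun_eq_iff)
qed

lemma card_orth_UNIV:
  fixes U :: "('a ^ 'n) set"
  assumes U: "U \<subseteq> fvecs F"
  shows "card (orth UNIV U) = card (orth F U) ^ m"
proof -
  define expand where "expand x = (\<lambda>t\<in>{..<m}. coord_vec x t)" for x :: "'a ^ 'n"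
  define collect where "collect z = (\<chi> i. combine (\<lambda>t\<in>{..<m}. z t $ i))" for z :: "nat \<Rightarrow> 'a ^ 'n"
  have in_orth: "x \<in> orth UNIV U \<longleftrightarrow> (\<forall>t<m. coord_vec x t \<in> orth F U)" for x
    by (auto simp: orth_def dot_eq_0_iff_coord_vec[OF subsetD[OF U]] coord_vec_in_fvecs)
  have coord_vec_collect: "coord_vec (collect z) t = z t"
    if "z \<in> PiE {..<m} (\<lambda>_. orth F U)" "t < m" for z t
  proof -
    have "(\<lambda>t\<in>{..<m}. z t $ i) \<in> coeffs" for i
      using that(1) by (auto simp: coeffs_def orth_def fvecs_def)
    with that(2) show ?thesis
      by (simp add: coord_vec_def collect_def coords_combine vec_eq_iff)
  qed
  have "bij_betw expand (orth UNIV U) (PiE {..<m} (\<lambda>_. orth F U))"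
  proof (rule bij_betwI[where g = collect])
    show "expand \<in> orth UNIV U \<rightarrow> PiE {..<m} (\<lambda>_. orth F U)"
      using in_orth by (auto simp: expand_def)
    show "collect \<in> PiE {..<m} (\<lambda>_. orth F U) \<rightarrow> orth UNIV U"
      using in_orth coord_vec_collect by auto
    show "collect (expand x) = x" for x
    proof -
      have "(\<lambda>t\<in>{..<m}. expand x t $ i) = coords (x $ i)" for i
        using coords_eq_undefined by (auto simp: expand_def coord_vec_def)
      then show ?thesis
        by (simp add: collect_def vec_eq_iff)
    qed
    show "expand (collect z) = z" if "z \<in> PiE {..<m} (\<lambda>_. orth F U)" for z
      using that coord_vec_collect by (auto simp: expand_def PiE_def extensional_def)
  qed
  then show ?thesis
    by (simp add: bij_betw_same_card card_PiE)
qed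

end

section \<open>Rank\<close>

context gf_subfield
begin

lemma rk_eq_length:
  fixes x :: "'a ^ 'n"
  assumes "distinct ws" "lspan (*) F ws = Fspan F (range (\<lambda>i. x $ i))"
    and "card (lspan (*) F ws) = q ^ length ws"
  shows "rk F x = length ws"
proof -
  obtain vs where vs: "set vs = range (\<lambda>i. x $ i)"
    using finite_list[of "range (\<lambda>i. x $ i)"] by auto
  have "range (\<lambda>i. x $ i) \<subseteq> Fspan F (set ws)"
    using vs assms(2) vector_space_over_itself.set_subset_lspan[OF subfield, of vs]
      Fspan_eq_lspan[OF subfield vs] Fspan_eq_lspan[OF subfield, of ws "set ws"]
    by simp
  moreover have "length ws \<le> d"
    if B: "finite B" "card B = d" "range (\<lambda>i. x $ i) \<subseteq> Fspan F B" for B d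
  proof -
    obtain bs where bs: "set bs = B" "distinct bs"
      using finite_distinct_list[OF B(1)] by blast
    have "lspan (*) F vs \<subseteq> lspan (*) F bs"
    proof (rule vector_space_over_itself.lspan_minimal[OF subfield])
      show "set vs \<subseteq> lspan (*) F bs"
        using vs B(3) Fspan_eq_lspan[OF subfield bs(1)] by simp
    qed (simp_all add: vector_space_over_itself.lspan_zero[OF subfield]
                       vector_space_over_itself.lspan_add[OF subfield]
                       vector_space_over_itself.lspan_scale[OF subfield])
    then have "q ^ length ws \<le> card (lspan (*) F bs)"
      using assms(2,3) Fspan_eq_lspan[OF subfield vs] card_mono[of "lspan (*) F bs" "lspan (*) F ws"] by simp
    also have "\<dots> \<le> q ^ length bs"
      using vector_space_over_itself.card_lspan_le[OF subfield, of bs] card_F by simp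
    finally have "length ws \<le> length bs"
      by (rule power_le_imp_le_exp[rotated]) (use two_le_q in linarith)
    with bs B(2) show ?thesis
      using distinct_card[of bs] by simp
  qed
  ultimately show ?thesis
    unfolding rk_def using assms(1)
    by (intro Least_equality exI[of _ "set ws"]) (auto simp: distinct_card)
qed

lemma ex_rank_list:
  fixes x :: "'a ^ 'n"
  obtains ws where "distinct ws" "set ws \<subseteq> range (\<lambda>i. x $ i)"
    "lspan (*) F ws = Fspan F (range (\<lambda>i. x $ i))" "card (lspan (*) F ws) = q ^ length ws"
proof -
  obtain vs where vs: "set vs = range (\<lambda>i. x $ i)"
    using finite_list[of "range (\<lambda>i. x $ i)"] by auto
  with vector_space_over_itself.ex_independent_sublist[OF subfield, of vs] that show ?thesis
    by (auto simp: Fspan_eq_lspan[OF subfield vs] card_F)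
qed

lemma card_Fspan_eq_power_rk: "card (Fspan F (range (\<lambda>i. (x :: 'a ^ 'n) $ i))) = q ^ rk F x"
  by (metis ex_rank_list rk_eq_length)

lemma rk_le: "rk F (x :: 'a ^ 'n) \<le> CARD('n)"
proof -
  obtain ws where ws: "distinct ws" "set ws \<subseteq> range (\<lambda>i. x $ i)"
    "lspan (*) F ws = Fspan F (range (\<lambda>i. x $ i))" "card (lspan (*) F ws) = q ^ length ws"
    by (rule ex_rank_list)
  then have "rk F x = card (set ws)"
    by (simp add: rk_eq_length distinct_card)
  also have "\<dots> \<le> card (range (\<lambda>i. x $ i))"
    using ws(2) by (intro card_mono) simp_all
  also have "\<dots> \<le> CARD('n)"
    by (rule card_image_le) simp
  finally show ?thesis .
qed

lemma dot_image_fvecs: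
  fixes x :: "'a ^ 'n"
  shows "(\<lambda>l. dot l x) ` fvecs F = Fspan F (range (\<lambda>i. x $ i))"
proof -
  obtain vs where vs: "set vs = range (\<lambda>i. x $ i)"
    using finite_list[of "range (\<lambda>i. x $ i)"] by auto
  have "(\<lambda>l. dot l x) ` fvecs F \<subseteq> lspan (*) F vs"
  proof clarify
    fix l :: "'a ^ 'n"
    assume "l \<in> fvecs F"
    then have "l $ i * x $ i \<in> lspan (*) F vs" for i
      using vs vector_space_over_itself.set_subset_lspan[OF subfield, of vs]
      by (auto simp: fvecs_def intro!: vector_space_over_itself.lspan_scale[OF subfield])
    then show "dot l x \<in> lspan (*) F vs"
      unfolding dot_def by (rule vector_space_over_itself.lspan_sum[OF subfield])
  qed
  moreover have "lspan (*) F vs \<subseteq> (\<lambda>l. dot l x) ` fvecs F"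
  proof (rule vector_space_over_itself.lspan_minimal[OF subfield])
    show "0 \<in> (\<lambda>l. dot l x) ` fvecs F"
      using fvecs_zero[OF subfield] by force
    show "a + b \<in> (\<lambda>l. dot l x) ` fvecs F"
      if "a \<in> (\<lambda>l. dot l x) ` fvecs F" "b \<in> (\<lambda>l. dot l x) ` fvecs F" for a b
      using that fvecs_add[OF subfield] by (force simp: dot_add_left)
    show "c * a \<in> (\<lambda>l. dot l x) ` fvecs F" if "c \<in> F" "a \<in> (\<lambda>l. dot l x) ` fvecs F" for c a
      using that fvecs_scale[OF subfield] by (force simp: dot_scale_left)
    show "set vs \<subseteq> (\<lambda>l. dot l x) ` fvecs F"
      using vs axis_in_fvecs[OF subfield] by (force simp: dot_axis_left)
  qed
  ultimately show ?thesis
    by (simp add: Fspan_eq_lspan[OF subfield vs])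
qed

lemma card_orth_singleton: "card (orth F {x :: 'a ^ 'n}) = q ^ (CARD('n) - rk F x)"
proof -
  have "card (fvecs F :: ('a ^ 'n) set)
      = card ((\<lambda>l. dot l x) ` fvecs F) * card {l\<in>fvecs F. dot l x = 0}"
    by (intro card_eq_card_image_mult_card_kernel)
       (simp_all add: fvecs_add[OF subfield] fsubspace_diff[OF subfield fsubspace_fvecs[OF subfield]]
                      dot_add_left)
  then have "q ^ rk F x * q ^ (CARD('n) - rk F x) = q ^ rk F x * card (orth F {x})"
    using rk_le[of x] by (simp add: card_fvecs card_F dot_image_fvecs card_Fspan_eq_power_rk
                                    orth_def flip: power_add)
  then show ?thesis
    using two_le_q by simp
qed

end

section \<open>Counting subspaces over the subfield\<close>

context gf_subfield
begin

definition indep_lists :: "nat \<Rightarrow> ('a ^ 'n) set \<Rightarrow> ('a ^ 'n) list set" where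
  "indep_lists d V = {vs. length vs = d \<and> set vs \<subseteq> V \<and> card (lspan (*s) F vs) = q ^ d}"

definition fsubspaces :: "nat \<Rightarrow> ('a ^ 'n) set \<Rightarrow> ('a ^ 'n) set set" where
  "fsubspaces d V = {U. fsubspace F U \<and> U \<subseteq> V \<and> card U = q ^ d}"

lemma lspan_subset_fsubspace:
  fixes V :: "('a ^ 'n) set"
  assumes "fsubspace F V" "set vs \<subseteq> V"
  shows "lspan (*s) F vs \<subseteq> V"
  using assms unfolding fsubspace_def by (intro vec.lspan_minimal[OF subfield]) auto

lemma fsubspace_lspan:
  fixes vs :: "('a ^ 'n) list"
  assumes "set vs \<subseteq> fvecs F"
  shows "fsubspace F (lspan (*s) F vs)"
  using lspan_subset_fsubspace[OF fsubspace_fvecs[OF subfield] assms]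
  by (simp add: fsubspace_def vec.lspan_zero[OF subfield] vec.lspan_add[OF subfield]
                vec.lspan_scale[OF subfield])

lemma card_lspan_Cons_vec:
  fixes vs :: "('a ^ 'n) list"
  shows "v \<notin> lspan (*s) F vs \<Longrightarrow> card (lspan (*s) F (v # vs)) = q * card (lspan (*s) F vs)"
  using vec.card_lspan_Cons[OF subfield] card_F by simp

lemma indep_lists_Suc:
  "indep_lists (Suc d) V = (\<lambda>(vs, v). v # vs) ` (SIGMA vs:indep_lists d V. V - lspan (*s) F vs)"
proof (intro set_eqI iffI)
  fix ws
  assume ws: "ws \<in> indep_lists (Suc d) V"
  then obtain v vs where v: "ws = v # vs" "length vs = d" "v \<in> V" "set vs \<subseteq> V"
    by (cases ws) (auto simp: indep_lists_def)
  have "v \<notin> lspan (*s) F vs"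
  proof
    assume "v \<in> lspan (*s) F vs"
    then have "q ^ Suc d \<le> q ^ d"
      using ws v vec.card_lspan_le[OF subfield, of vs] card_F
      by (simp add: indep_lists_def vec.lspan_Cons_absorb[OF subfield])
    then show False
      using two_le_q by simp
  qed
  with ws v have "vs \<in> indep_lists d V"
    using two_le_q by (simp add: indep_lists_def card_lspan_Cons_vec)
  with v \<open>v \<notin> lspan (*s) F vs\<close> show "ws \<in> (\<lambda>(vs, v). v # vs) ` (SIGMA vs:indep_lists d V. V - lspan (*s) F vs)"
    by force
next
  fix ws
  assume "ws \<in> (\<lambda>(vs, v). v # vs) ` (SIGMA vs:indep_lists d V. V - lspan (*s) F vs)"
  then show "ws \<in> indep_lists (Suc d) V"
    by (auto simp: indep_lists_def card_lspan_Cons_vec)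
qed

lemma finite_indep_lists: "finite (indep_lists d V)"
  by (rule finite_subset[of _ "{xs. set xs \<subseteq> V \<and> length xs = d}"])
     (auto simp: indep_lists_def intro: finite_lists_length_eq)

lemma card_indep_lists:
  fixes V :: "('a ^ 'n) set"
  assumes V: "fsubspace F V" "card V = q ^ e"
  shows "real (card (indep_lists d V)) = qframes (real q) e d"
proof (induction d)
  case 0
  have "indep_lists 0 V = {[]}"
    by (rule set_eqI) (auto simp: indep_lists_def vec.lspan_Nil[OF subfield])
  then show ?case
    by simp
next
  case (Suc d)
  have "card (V - lspan (*s) F vs) = q ^ e - q ^ d" if "vs \<in> indep_lists d V" for vs
    using that V lspan_subset_fsubspace[OF V(1)] by (simp add: indep_lists_def card_Diff_subset)
  moreover have "inj_on (\<lambda>(vs, v). v # vs) (SIGMA vs:indep_lists d V. V - lspan (*s) F vs)"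
    by (rule inj_onI) auto
  ultimately have "card (indep_lists (Suc d) V) = card (indep_lists d V) * (q ^ e - q ^ d)"
    unfolding indep_lists_Suc by (simp add: card_image card_SigmaI finite_indep_lists)
  moreover have "real (q ^ e - q ^ d) = real q ^ e - real q ^ d" if "d \<le> e"
    using that two_le_q by (simp add: of_nat_diff power_increasing)
  ultimately show ?case
    using Suc by (cases "d \<le> e") (simp_all add: qframes_Suc qframes_eq_0)
qed

lemma lspan_eq_if_indep_lists:
  fixes U :: "('a ^ 'n) set"
  assumes "fsubspace F U" "card U = q ^ d" "vs \<in> indep_lists d U"
  shows "lspan (*s) F vs = U"
  using assms lspan_subset_fsubspace[of U vs]
  by (intro card_subset_eq) (simp_all add: indep_lists_def)

lemma indep_lists_eq_UN_fsubspaces: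
  fixes V :: "('a ^ 'n) set"
  assumes V: "fsubspace F V"
  shows "indep_lists d V = (\<Union>U\<in>fsubspaces d V. indep_lists d U)"
proof (intro set_eqI iffI)
  fix vs
  assume vs: "vs \<in> indep_lists d V"
  then have "set vs \<subseteq> V" "card (lspan (*s) F vs) = q ^ d"
    by (simp_all add: indep_lists_def)
  moreover have "V \<subseteq> fvecs F"
    using V by (simp add: fsubspace_def)
  ultimately have "lspan (*s) F vs \<in> fsubspaces d V"
    using fsubspace_lspan[of vs] lspan_subset_fsubspace[OF V] by (auto simp: fsubspaces_def)
  moreover have "vs \<in> indep_lists d (lspan (*s) F vs)"
    using vs vec.set_subset_lspan[OF subfield] by (auto simp: indep_lists_def)
  ultimately show "vs \<in> (\<Union>U\<in>fsubspaces d V. indep_lists d U)"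
    by blast
qed (auto simp: indep_lists_def fsubspaces_def)

lemma card_fsubspaces:
  fixes V :: "('a ^ 'n) set"
  assumes V: "fsubspace F V" "card V = q ^ e"
  shows "real (card (fsubspaces d V)) = gauss_binom (real q) e d"
proof -
  have card_eq: "card (indep_lists d V) = (\<Sum>U\<in>fsubspaces d V. card (indep_lists d U))"
    unfolding indep_lists_eq_UN_fsubspaces[OF V(1)]
  proof (rule card_UN_disjoint)
    show "finite (fsubspaces d V)"
      by (rule finite_subset[of _ "Pow V"]) (auto simp: fsubspaces_def)
    show "\<forall>U\<in>fsubspaces d V. \<forall>U'\<in>fsubspaces d V. U \<noteq> U' \<longrightarrow> indep_lists d U \<inter> indep_lists d U' = {}"
    proof (intro ballI impI equals0I)
      fix U U' vs
      assume "U \<in> fsubspaces d V" "U' \<in> fsubspaces d V" "U \<noteq> U'"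
        and "vs \<in> indep_lists d U \<inter> indep_lists d U'"
      then show False
        using lspan_eq_if_indep_lists[of U d vs] lspan_eq_if_indep_lists[of U' d vs]
        by (simp add: fsubspaces_def)
    qed
  qed (simp add: finite_indep_lists)
  have "real (card (indep_lists d V)) = (\<Sum>U\<in>fsubspaces d V. qframes (real q) d d)"
    unfolding card_eq of_nat_sum
  proof (rule sum.cong[OF refl])
    fix U
    assume "U \<in> fsubspaces d V"
    then show "real (card (indep_lists d U)) = qframes (real q) d d"
      using card_indep_lists[of U d d] by (simp add: fsubspaces_def)
  qed
  then have "qframes (real q) e d = real (card (fsubspaces d V)) * qframes (real q) d d"
    using card_indep_lists[OF V, of d] by simp
  moreover have "0 < qframes (real q) d d"
    using two_le_q qframes_pos[of "real q" d d] by simp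
  ultimately show ?thesis
    unfolding gauss_binom_def by (simp add: field_simps)
qed

end

section \<open>Gaussian binomial moments of the rank distribution\<close>

context gf_subfield
begin

lemma fsubspaces_orth_singleton:
  fixes x :: "'a ^ 'n"
  shows "fsubspaces u (orth F {x}) = {U \<in> fsubspaces u (fvecs F). x \<in> orth UNIV U}"
  by (rule set_eqI) (auto simp: fsubspaces_def orth_def dot_commute fsubspace_def)

lemma sum_card_fsubspaces_orth_singleton:
  fixes D :: "('a ^ 'n) set"
  shows "(\<Sum>x\<in>D. card (fsubspaces u (orth F {x})))
       = (\<Sum>U\<in>fsubspaces u (fvecs F). card (D \<inter> orth UNIV U))"
  using sum.swap[where g = "\<lambda>x U. of_bool (x \<in> orth UNIV U) :: nat" and A = D
      and B = "fsubspaces u (fvecs F)"]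
  by (simp add: fsubspaces_orth_singleton Collect_conj_eq)

lemma card_orth_fsubspace:
  fixes U :: "('a ^ 'n) set"
  assumes "U \<in> fsubspaces u (fvecs F)" "u \<le> CARD('n)"
  shows "card (orth F U) = q ^ (CARD('n) - u)"
proof -
  have "q ^ u * card (orth F U) = q ^ u * q ^ (CARD('n) - u)"
    using card_mult_card_orth[OF subfield, of U] assms by (simp add: fsubspaces_def card_F flip: power_add)
  then show ?thesis
    using two_le_q by simp
qed

lemma bij_betw_orth_fsubspaces:
  assumes "u \<le> CARD('n)"
  shows "bij_betw (orth F) (fsubspaces u (fvecs F :: ('a ^ 'n) set)) (fsubspaces (CARD('n) - u) (fvecs F))"
proof (rule bij_betwI[where g = "orth F"])
  have "orth F U \<in> fsubspaces (CARD('n) - u') (fvecs F)"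
    if "U \<in> fsubspaces u' (fvecs F)" "u' \<le> CARD('n)" for U :: "('a ^ 'n) set" and u'
    using that card_orth_fsubspace[OF that] fsubspace_orth[OF subfield, of U] orth_subset_fvecs[of F U]
    by (simp add: fsubspaces_def)
  with assms show "orth F \<in> fsubspaces u (fvecs F :: ('a ^ 'n) set) \<rightarrow> fsubspaces (CARD('n) - u) (fvecs F)"
    and "orth F \<in> fsubspaces (CARD('n) - u) (fvecs F :: ('a ^ 'n) set) \<rightarrow> fsubspaces u (fvecs F)"
    by fastforce+
qed (simp_all add: fsubspaces_def orth_orth[OF subfield])

text \<open>Both \<open>orth UNIV (orth UNIV U)\<close> and \<open>orth UNIV (orth F U)\<close> are the span of \<open>U\<close> over the
  big field.\<close>

lemma orth_UNIV_orth_fsubspace: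
  fixes U :: "('a ^ 'n) set"
  assumes U: "U \<in> fsubspaces u (fvecs F)" and "u \<le> CARD('n)"
  shows "card (orth UNIV (orth F U)) = (q ^ m) ^ u"
    and "orth UNIV (orth UNIV U) = orth UNIV (orth F U)"
proof -
  have UF: "U \<subseteq> fvecs F" "fsubspace F U" "card U = q ^ u"
    using U by (auto simp: fsubspaces_def)
  show card_eq: "card (orth UNIV (orth F U)) = (q ^ m) ^ u"
    using card_orth_UNIV[OF orth_subset_fvecs[of F U]] orth_orth[OF subfield UF(2)] UF(3)
    by (simp add: power_mult[symmetric] mult.commute)
  have "card (orth UNIV U) = (q ^ m) ^ (CARD('n) - u)"
    using card_orth_UNIV[OF UF(1)] card_orth_fsubspace[OF assms]
    by (simp add: power_mult[symmetric] mult.commute)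
  moreover have "card (orth UNIV U) * card (orth UNIV (orth UNIV U)) = (q ^ m) ^ CARD('n)"
    using card_mult_card_orth[OF subfield_UNIV fsubspace_orth[OF subfield_UNIV, of U]]
    by (simp add: CARD_field)
  moreover have "(q ^ m) ^ CARD('n) = (q ^ m) ^ (CARD('n) - u) * (q ^ m) ^ u"
    using assms(2) by (simp flip: power_add)
  ultimately have "card (orth UNIV (orth UNIV U)) = (q ^ m) ^ u"
    using two_le_q by simp
  moreover have "orth UNIV (orth UNIV U) \<subseteq> orth UNIV (orth F U)"
    by (intro orth_antimono) (auto simp: orth_def)
  ultimately show "orth UNIV (orth UNIV U) = orth UNIV (orth F U)"
    using card_eq by (intro card_subset_eq) simp_all
qed

lemma card_inter_orth_fsubspace:
  fixes C U :: "('a ^ 'n) set"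
  assumes C: "vec.subspace C" and U: "U \<in> fsubspaces u (fvecs F)" and u: "u \<le> CARD('n)"
  shows "card (C \<inter> orth UNIV U) * (q ^ m) ^ u = card C * card (dual_code C \<inter> orth UNIV (orth F U))"
  using card_inter_mult_card_orth[OF subfield_UNIV, of C "orth UNIV U"]
    fsubspace_orth[OF subfield_UNIV, of U] orth_UNIV_orth_fsubspace[OF U u] C
  by (simp add: fsubspace_UNIV_iff dual_code_eq_orth)

lemma sum_gauss_binom_rk_dual_code:
  fixes C :: "('a ^ 'n) set"
  assumes C: "vec.subspace C" and u: "u \<le> CARD('n)"
  shows "real (q ^ m) ^ u * (\<Sum>x\<in>C. gauss_binom (real q) (CARD('n) - rk F x) u)
       = real (card C) * (\<Sum>y\<in>dual_code C. gauss_binom (real q) (CARD('n) - rk F y) (CARD('n) - u))"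
proof -
  have count: "gauss_binom (real q) (CARD('n) - rk F x) k = real (card (fsubspaces k (orth F {x})))"
    for k and x :: "'a ^ 'n"
    by (rule card_fsubspaces[OF fsubspace_orth[OF subfield] card_orth_singleton, symmetric])
  have "real (q ^ m) ^ u * (\<Sum>x\<in>C. gauss_binom (real q) (CARD('n) - rk F x) u)
      = (\<Sum>U\<in>fsubspaces u (fvecs F). real (card (C \<inter> orth UNIV U) * (q ^ m) ^ u))"
    unfolding count of_nat_sum[symmetric] sum_card_fsubspaces_orth_singleton
    by (simp add: sum_distrib_left mult.commute)
  also have "\<dots> = (\<Sum>U\<in>fsubspaces u (fvecs F). real (card C * card (dual_code C \<inter> orth UNIV (orth F U))))"
    using card_inter_orth_fsubspace[OF C _ u] by simp
  also have "\<dots> = real (card C) * (\<Sum>U\<in>fsubspaces (CARD('n) - u) (fvecs F).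
                                          real (card (dual_code C \<inter> orth UNIV U)))"
    using sum.reindex_bij_betw[OF bij_betw_orth_fsubspaces[OF u],
        of "\<lambda>U. real (card C) * real (card (dual_code C \<inter> orth UNIV U))"]
    by (simp add: sum_distrib_left)
  also have "(\<Sum>U\<in>fsubspaces (CARD('n) - u) (fvecs F). real (card (dual_code C \<inter> orth UNIV U)))
      = (\<Sum>y\<in>dual_code C. gauss_binom (real q) (CARD('n) - rk F y) (CARD('n) - u))"
    unfolding count of_nat_sum[symmetric] sum_card_fsubspaces_orth_singleton ..
  finally show ?thesis .
qed

lemma sum_rank_we:
  fixes D :: "('a ^ 'n) set"
  shows "(\<Sum>i=0..CARD('n). hc (rank_we F D) i M * g i) = (\<Sum>x\<in>D. g (rk F x))"
proof -
  have "(\<Sum>i=0..CARD('n). hc (rank_we F D) i M * g i) = (\<Sum>i=0..CARD('n). real (card {x\<in>D. rk F x = i}) * g i)"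
    by (rule sum.cong) (simp_all add: hc_rank_we)
  also have "\<dots> = (\<Sum>x\<in>D. g (rk F x))"
    by (rule sum_eq_sum_card_fibres[symmetric]) (simp_all add: rk_le)
  finally show ?thesis .
qed

lemma gauss_binom_moments_rank_we:
  fixes C :: "('a ^ 'n) set"
  assumes "vec.subspace C" "u \<le> CARD('n)"
  shows "(real q powi int m) ^ u * (\<Sum>i=0..CARD('n). hc (rank_we F C) i (int m) * gauss_binom (real q) (CARD('n) - i) u)
       = real (card C) * (\<Sum>j=0..CARD('n). hc (rank_we F (dual_code C)) j (int m)
                                              * gauss_binom (real q) (CARD('n) - j) (CARD('n) - u))"
proof -
  have "(\<Sum>i=0..CARD('n). hc (rank_we F C) i (int m) * gauss_binom (real q) (CARD('n) - i) u)
      = (\<Sum>x\<in>C. gauss_binom (real q) (CARD('n) - rk F x) u)"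
    by (rule sum_rank_we)
  moreover have "(\<Sum>j=0..CARD('n). hc (rank_we F (dual_code C)) j (int m)
                                    * gauss_binom (real q) (CARD('n) - j) (CARD('n) - u))
      = (\<Sum>y\<in>dual_code C. gauss_binom (real q) (CARD('n) - rk F y) (CARD('n) - u))"
    by (rule sum_rank_we)
  ultimately show ?thesis
    using sum_gauss_binom_rk_dual_code[OF assms] by (simp add: power_int_of_nat)
qed

end

theorem theorem1:
  fixes F :: "'a::{field,finite} set"
    and C :: "('a ^ 'n) set"
    and q m k :: nat
  assumes "is_subfield F"
    and "card F = q"
    and "m \<ge> 1"
    and "CARD('a) = q ^ m"
    and "vec.subspace C"
    and "vec.dim C = k"
  shows "\<forall>j\<le>CARD('n).
           hc (rank_we F (dual_code C)) j (int m)
           = hc (qtransform_at q (rank_we F C) (Xpoly q) Ypoly) j (int m) / real (card C)"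
proof (intro allI impI)
  interpret gf_subfield F q m
    using assms(1,2,4) by unfold_locales
  fix j
  assume "j \<le> CARD('n)"
  have "1 < q"
    using two_le_q by simp
  moreover have "real (card C) \<noteq> 0"
    using assms(5) by (auto simp: vec.subspace_def)
  ultimately show "hc (rank_we F (dual_code C)) j (int m)
      = hc (qtransform_at q (rank_we F C) (Xpoly q) Ypoly) j (int m) / real (card C)"
    using qbasis_coeff_inversion[OF _ _ gauss_binom_moments_rank_we[OF assms(5)] \<open>j \<le> CARD('n)\<close>]
      \<open>j \<le> CARD('n)\<close>
    by (simp add: hc_qtransform_at)
qed

end
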